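(* Let $P\subset M_\mathbb{R}$ be a reflexive polytope and let $\Pi(P)=\{P_1,\dots,P_r\}$ be a nef-partition of $P$. Then $\Pi(P)$ is irreducible if and only if the associated Cayley polytope $\widetilde P=P_1*\cdots*P_r$ is an irreducible Gorenstein polytope.
   Context: Let $M\cong\mathbb{Z}^d$ be a lattice with dual $N$ and pairing $\langle\cdot,\cdot\rangle$. A full-dimensional lattice polytope $P\subset M_\mathbb{R}$ is reflexive if $0$ is in its interior and $0$ has integral distance $1$ to every facet's supporting hyperplane. Nef-partition: a Minkowski sum decomposition $P=P_1+\dots+P_r$ into nonempty lattice polytopes with $0\in P_i$ for each $i$ is called a nef-partition $\Pi(P)=\{P_1,\dots,P_r\}$. It is irreducible if there is no proper nonempty subset $\{i_1,\dots,i_s\}\subset\{1,\dots,r\}$ such that $P_{i_1}+\dots+P_{i_s}$ contains $0$ in its relative interior. Cayley polytope: $P_1*\cdots*P_r=\operatorname{conv}\big(\bigcup_i P_i\times\{e_i\}\big)\subset(M\oplus\mathbb{Z}^r)_\mathbb{R}$, where $e_i$ are the standard basis vectors of $\mathbb{Z}^r$. It is regarded as a lattice polytope with respect to the affine lattice $M\times\{x_1+\dots+x_r=1\}$. For a nef-partition it is a Gorenstein polytope of dimension $d+r-1$ and index $r$. Codegree: for a lattice polytope $Q$ (each face taken with respect to the lattice points of its affine hull), $\operatorname{codeg}Q$ is the least positive integer $k$ with a lattice point in the relative interior of $kQ$, and $\operatorname{codeg}\emptyset=0$. Gorenstein duality: a lattice polytope $Q$ of full dimension $D$ in $L_\mathbb{R}$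 is Gorenstein of index $r$ if $rQ$ has a unique interior lattice point $m$ and $rQ-m$ is reflexive. Let $C_Q\subset(L\oplus\mathbb{Z})_\mathbb{R}$ be the cone over $Q\times\{1\}$. The dual Gorenstein polytope is $Q^\times=\{y\in C_Q^\vee:\langle y,(m,r)\rangle=1\}$. For a face $F$ of $Q$, the dual face is $F^*=\{y\in Q^\times:\langle y,(x,1)\rangle=0\ \forall x\in F\}$. A nonempty Gorenstein polytope $Q$ of index $r$ is irreducible if there is no proper face $F$ (i.e. $F\neq\emptyset$, $F\ne Q$) with $\operatorname{codeg}F+\operatorname{codeg}F^*=r$. *)

theory Defs
  imports "HOL-Analysis.Analysis" "HOL-Library.Set_Algebras"
begin

text \<open>
  A lattice of rank \<open>d\<close> is the integer span of \<open>d\<close> linearly independent vectors of a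
  Euclidean space; rank 0 is allowed. The real vector space of a lattice \<open>L\<close> is \<open>span L\<close>,
  which may be a proper subspace of the ambient space.
\<close>

definition is_lattice :: "'a::euclidean_space set \<Rightarrow> bool" where
  "is_lattice L \<longleftrightarrow>
     (\<exists>B. independent B \<and> L = {(\<Sum>b\<in>B. real_of_int (c b) *\<^sub>R b) |c. True})"

text \<open>
  The inner product, restricted to \<open>span L\<close>, is used as the pairing between \<open>span L\<close> and
  its dual space, so that dual vectors are represented by elements of \<open>span L\<close>.
\<close>

definition dual_lattice :: "'a::euclidean_space set \<Rightarrow> 'a set" where
  "dual_lattice L = {y \<in> span L. \<forall>x\<in>L. y \<bullet> x \<in> \<int>}"

definition primitive :: "'a::euclidean_space set \<Rightarrow> 'a \<Rightarrow> bool" where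
  "primitive L u \<longleftrightarrow>
     u \<in> L \<and> u \<noteq> 0 \<and> (\<forall>v\<in>L. \<forall>k::nat. u = real k *\<^sub>R v \<longrightarrow> k = 1)"

definition lattice_polytope :: "'a::euclidean_space set \<Rightarrow> 'a set \<Rightarrow> bool" where
  "lattice_polytope L P \<longleftrightarrow> (\<exists>V. finite V \<and> V \<subseteq> L \<and> P = convex hull V)"

text \<open>
  The integral distance of 0 to the hyperplane \<open>u \<bullet> x = c\<close> with \<open>u\<close> primitive in the dual
  lattice is \<open>\<bar>c\<bar>\<close>; replacing \<open>u\<close> by \<open>-u\<close> if necessary, distance 1 means \<open>c = 1\<close>.
  Since \<open>P\<close> is full-dimensional in \<open>span M\<close>, its interior there is \<open>rel_interior P\<close>.
\<close>

definition reflexive :: "'a::euclidean_space set \<Rightarrow> 'a set \<Rightarrow> bool" where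
  "reflexive M P \<longleftrightarrow>
     lattice_polytope M P \<and> affine hull P = span M \<and> 0 \<in> rel_interior P \<and>
     (\<forall>F. F facet_of P \<longrightarrow>
        (\<exists>u. primitive (dual_lattice M) u \<and> affine hull F = {x \<in> span M. u \<bullet> x = 1}))"

text \<open>
  A nef-partition is a family indexed by a finite type \<open>'r\<close> (so \<open>r = CARD('r) \<ge> 1\<close>);
  sums of sets are Minkowski sums.
\<close>

definition nef_partition ::
    "'a::euclidean_space set \<Rightarrow> 'a set \<Rightarrow> ('r::finite \<Rightarrow> 'a set) \<Rightarrow> bool" where
  "nef_partition M P Ps \<longleftrightarrow>
     P = (\<Sum>i\<in>UNIV. Ps i) \<and> (\<forall>i. lattice_polytope M (Ps i) \<and> 0 \<in> Ps i)"

definition irreducible_nef_partition :: "('r::finite \<Rightarrow> 'a::euclidean_space set) \<Rightarrow> bool" where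
  "irreducible_nef_partition Ps \<longleftrightarrow>
     \<not> (\<exists>I. I \<noteq> {} \<and> I \<noteq> UNIV \<and> 0 \<in> rel_interior (\<Sum>i\<in>I. Ps i))"

definition cayley_polytope ::
    "('r::finite \<Rightarrow> 'a::euclidean_space set) \<Rightarrow> ('a \<times> (real ^ 'r)) set" where
  "cayley_polytope Ps = convex hull (\<Union>i. Ps i \<times> {axis i 1})"

definition cayley_lattice :: "'a::euclidean_space set \<Rightarrow> ('a \<times> (real ^ 'r::finite)) set" where
  "cayley_lattice M = M \<times> {v. (\<forall>i. v $ i \<in> \<int>) \<and> (\<Sum>i\<in>UNIV. v $ i) = 1}"

definition codeg :: "'a::euclidean_space set \<Rightarrow> 'a set \<Rightarrow> nat" where
  "codeg L Q =
     (if Q = {} then 0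
      else LEAST k. 0 < k \<and> L \<inter> rel_interior ((\<lambda>x. real k *\<^sub>R x) ` Q) \<noteq> {})"

text \<open>\<open>gorenstein L r m Q\<close>: the polytope \<open>Q\<close> is Gorenstein of index \<open>r\<close>, with \<open>m\<close> the unique
  interior lattice point of \<open>rQ\<close>.\<close>

definition gorenstein :: "'a::euclidean_space set \<Rightarrow> nat \<Rightarrow> 'a \<Rightarrow> 'a set \<Rightarrow> bool" where
  "gorenstein L r m Q \<longleftrightarrow>
     0 < r \<and> lattice_polytope L Q \<and> affine hull Q = span L \<and>
     L \<inter> rel_interior ((\<lambda>x. real r *\<^sub>R x) ` Q) = {m} \<and>
     reflexive L ((\<lambda>x. real r *\<^sub>R x - m) ` Q)"

definition polytope_cone :: "'a::euclidean_space set \<Rightarrow> ('a \<times> real) set" where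
  "polytope_cone Q = cone hull (Q \<times> {1})"

definition dual_cone :: "'a::euclidean_space set \<Rightarrow> 'a set \<Rightarrow> 'a set" where
  "dual_cone L C = {y \<in> span L. \<forall>z\<in>C. 0 \<le> y \<bullet> z}"

definition dual_gorenstein ::
    "'a::euclidean_space set \<Rightarrow> nat \<Rightarrow> 'a \<Rightarrow> 'a set \<Rightarrow> ('a \<times> real) set" where
  "dual_gorenstein L r m Q =
     {y \<in> dual_cone (L \<times> \<int>) (polytope_cone Q). y \<bullet> (m, real r) = 1}"

definition dual_face ::
    "'a::euclidean_space set \<Rightarrow> nat \<Rightarrow> 'a \<Rightarrow> 'a set \<Rightarrow> 'a set \<Rightarrow> ('a \<times> real) set" where
  "dual_face L r m Q F = {y \<in> dual_gorenstein L r m Q. \<forall>x\<in>F. y \<bullet> (x, 1) = 0}"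

definition irreducible_gorenstein :: "'a::euclidean_space set \<Rightarrow> 'a set \<Rightarrow> bool" where
  "irreducible_gorenstein L Q \<longleftrightarrow>
     Q \<noteq> {} \<and>
     (\<exists>r m. gorenstein L r m Q \<and>
        \<not> (\<exists>F. F face_of Q \<and> F \<noteq> {} \<and> F \<noteq> Q \<and>
              codeg L F + codeg (dual_lattice (L \<times> \<int>)) (dual_face L r m Q F) = r))"

text \<open>
  For a polytope with respect to an affine lattice \<open>A\<close>, the choice of an origin \<open>p \<in> A\<close>
  identifies \<open>A\<close> with the lattice \<open>A - p\<close>, and the polytope with its translate by \<open>-p\<close>.
\<close>

definition irreducible_gorenstein_at ::
    "'a::euclidean_space \<Rightarrow> 'a set \<Rightarrow> 'a set \<Rightarrow> bool" where
  "irreducible_gorenstein_at p A Q \<longleftrightarrow>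
     irreducible_gorenstein ((\<lambda>x. x - p) ` A) ((\<lambda>x. x - p) ` Q)"

end

theory Submission
  imports Defs
begin

text \<open>
  Write \<open>C\<close> for the Cayley polytope and describe functionals on its cone by pairs \<open>(-w, b)\<close>:
  nonnegativity on \<open>C\<close> means that \<open>b i\<close> is at least the maximum of \<open>w\<close> on \<open>Ps i\<close>. The dual
  Gorenstein polytope is the convex hull of the coordinate functionals and the functionals
  \<open>(-u, h u)\<close>, with \<open>u\<close> a facet normal of \<open>P\<close> and \<open>h i u\<close> the maximum of \<open>u\<close> on \<open>Ps i\<close>; these are
  integral because \<open>P\<close> is reflexive.

  For a face \<open>F\<close> let \<open>I\<close> be the set of coordinates not vanishing on \<open>F\<close>. An interior lattice point
  of a multiple of \<open>F\<close> has coordinates at least 1 on \<open>I\<close>, and one of a multiple of the dual face has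
  \<open>b\<close>-coordinates at least 1 off \<open>I\<close>. If the codegrees add up to \<open>r\<close>, equality holds
  everywhere; integrality then forces \<open>w \<le> 0\<close> on \<open>P\<close>, so \<open>w = 0\<close>, \<open>F\<close> is the Cayley polytope of
  the \<open>Ps i\<close> with \<open>i \<in> I\<close>, and 0 is an interior point of their sum. Conversely such an \<open>I\<close> gives a
  face with codegrees \<open>card I\<close> and \<open>r - card I\<close>.
\<close>

section \<open>Relative interiors and linear functionals\<close>

text \<open>The segment from \<open>y\<close> to a relative interior point \<open>x\<close> can be
  prolonged beyond \<open>x\<close> inside \<open>S\<close>. If the functional were larger at
  \<open>y\<close> than at \<open>x\<close>, it would fall below its minimum at the prolonged
  end.\<close>

lemma inner_eq_if_min_at_rel_interior:
  fixes S :: "'a::euclidean_space set"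
  assumes "convex S" "x \<in> rel_interior S" "\<And>y. y \<in> S \<Longrightarrow> a \<bullet> x \<le> a \<bullet> y" "y \<in> S"
  shows "a \<bullet> y = a \<bullet> x"
proof -
  obtain e where e: "e > 1" "(1 - e) *\<^sub>R y + e *\<^sub>R x \<in> S"
    using convex_rel_interior_iff[of S x] assms by auto
  have "a \<bullet> x \<le> (1 - e) * (a \<bullet> y) + e * (a \<bullet> x)"
    using assms(3)[OF e(2)] by (simp add: inner_add_right)
  then have "(e - 1) * (a \<bullet> y - a \<bullet> x) \<le> 0"
    by (simp add: algebra_simps)
  then have "a \<bullet> y \<le> a \<bullet> x"
    using e(1) by (simp add: mult_le_0_iff)
  then show ?thesis using assms(3)[OF assms(4)] by simp
qed

text \<open>A point of \<open>S\<close> outside the relative interior has a supporting functional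
  that is strict on the relative interior, hence not constant on \<open>S\<close>. This reduces
  interiority claims to a test on functionals.\<close>

lemma rel_interiorI_inner:
  fixes S :: "'a::euclidean_space set"
  assumes "convex S" "x \<in> S"
    and "\<And>a y. (\<And>y. y \<in> S \<Longrightarrow> a \<bullet> x \<le> a \<bullet> y) \<Longrightarrow> y \<in> S \<Longrightarrow> a \<bullet> y = a \<bullet> x"
  shows "x \<in> rel_interior S"
proof (rule ccontr)
  assume "x \<notin> rel_interior S"
  then obtain a where a: "\<And>y. y \<in> S \<Longrightarrow> a \<bullet> x \<le> a \<bullet> y"
      "\<And>y. y \<in> rel_interior S \<Longrightarrow> a \<bullet> x < a \<bullet> y"
    using supporting_hyperplane_rel_boundary[OF assms(1,2)] by metis
  obtain y where "y \<in> rel_interior S"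
    using assms(1,2) rel_interior_eq_empty by blast
  then show False
    using a(2)[of y] assms(3)[OF a(1), of y] rel_interior_subset by force
qed

lemma mem_rel_interior_scaled_iff:
  fixes S :: "'a::euclidean_space set"
  assumes "c \<noteq> 0"
  shows "x \<in> rel_interior ((\<lambda>x. c *\<^sub>R x) ` S) \<longleftrightarrow> (1 / c) *\<^sub>R x \<in> rel_interior S"
proof -
  have "rel_interior ((\<lambda>x. c *\<^sub>R x) ` S) = (\<lambda>x. c *\<^sub>R x) ` rel_interior S"
    using rel_interior_scaleR[OF assms, of S] by simp
  moreover have "x = c *\<^sub>R y \<longleftrightarrow> (1 / c) *\<^sub>R x = y" for y
    using assms by auto
  ultimately show ?thesis by (auto simp: image_iff)
qed

text \<open>This is the source of strict inequalities below; for an integral functional and a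
  lattice point \<open>x\<close> it improves to a value of at least 1.\<close>

lemma inner_pos_at_rel_interior_scaled:
  fixes S :: "'a::euclidean_space set"
  assumes "convex S" "0 < k" "x \<in> rel_interior ((\<lambda>x. k *\<^sub>R x) ` S)"
    and "\<And>y. y \<in> S \<Longrightarrow> 0 \<le> a \<bullet> y" and "y \<in> S" "a \<bullet> y \<noteq> 0"
  shows "0 < a \<bullet> x"
proof (rule ccontr)
  assume "\<not> 0 < a \<bullet> x"
  have r: "(1 / k) *\<^sub>R x \<in> rel_interior S"
    using assms(2,3) by (simp add: mem_rel_interior_scaled_iff)
  have neg: "a \<bullet> ((1 / k) *\<^sub>R x) \<le> 0"
    using \<open>\<not> 0 < a \<bullet> x\<close> assms(2) by (simp add: divide_nonpos_pos)
  have nonneg: "0 \<le> a \<bullet> ((1 / k) *\<^sub>R x)"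
    using r rel_interior_subset assms(4) by blast
  have "a \<bullet> y = a \<bullet> ((1 / k) *\<^sub>R x)"
    by (rule inner_eq_if_min_at_rel_interior[OF assms(1) r _ assms(5)])
       (use neg assms(4) in force)
  then show False using neg nonneg assms(6) by simp
qed

lemma inner_ge_on_convex_hull:
  fixes a :: "'a::real_inner"
  assumes "\<And>w. w \<in> W \<Longrightarrow> c \<le> a \<bullet> w" "z \<in> convex hull W"
  shows "c \<le> a \<bullet> z"
proof -
  have "convex hull W \<subseteq> {z. c \<le> a \<bullet> z}"
    using assms(1) by (intro hull_minimal convex_halfspace_ge) auto
  then show ?thesis using assms(2) by auto
qed

lemma inner_eq_on_convex_hull:
  fixes a :: "'a::real_inner"
  assumes "\<And>w. w \<in> W \<Longrightarrow> a \<bullet> w = c" "z \<in> convex hull W"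
  shows "a \<bullet> z = c"
proof -
  have "c \<le> a \<bullet> z" "- c \<le> (- a) \<bullet> z"
    by (rule inner_ge_on_convex_hull[OF _ assms(2)], simp add: assms(1))+
  then show ?thesis by simp
qed

lemma inner_max_on_convex_hull:
  fixes W :: "'a::real_inner set"
  assumes "finite W" "W \<noteq> {}"
  obtains v where "v \<in> W" "\<And>x. x \<in> convex hull W \<Longrightarrow> w \<bullet> x \<le> w \<bullet> v"
proof -
  obtain v where v: "v \<in> W" "\<And>x. x \<in> W \<Longrightarrow> w \<bullet> x \<le> w \<bullet> v"
  proof -
    have "Max ((\<lambda>x. w \<bullet> x) ` W) \<in> (\<lambda>x. w \<bullet> x) ` W"
      using assms by (intro Max_in) auto
    then obtain v where "v \<in> W" "Max ((\<lambda>x. w \<bullet> x) ` W) = w \<bullet> v" by auto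
    then show ?thesis using that assms(1) by (metis Max_ge finite_imageI imageI)
  qed
  have "w \<bullet> x \<le> w \<bullet> v" if "x \<in> convex hull W" for x
    using inner_ge_on_convex_hull[OF _ that, of "- (w \<bullet> v)" "- w"] v(2) by simp
  then show ?thesis using that v(1) by blast
qed

text \<open>A functional minimal at the barycentre of \<open>W\<close> has its minimum equal to its
  average over \<open>W\<close>, so it is constant on \<open>W\<close> and hence on the
  hull.\<close>

lemma sum_mem_rel_interior_convex_hull:
  fixes W :: "'a::euclidean_space set"
  assumes "finite W" "W \<noteq> {}"
  shows "\<Sum>W \<in> rel_interior ((\<lambda>x. real (card W) *\<^sub>R x) ` (convex hull W))"
proof -
  let ?n = "real (card W)"
  have n: "?n > 0" using assms by (simp add: card_gt_0_iff)
  let ?m = "(1 / ?n) *\<^sub>R \<Sum>W"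
  have "?m = (\<Sum>w\<in>W. (1 / ?n) *\<^sub>R w)" by (simp add: scaleR_sum_right)
  also have "\<dots> \<in> convex hull W"
    using n assms by (intro convex_sum) (auto simp: hull_inc)
  finally have mem: "?m \<in> convex hull W" .
  have "?m \<in> rel_interior (convex hull W)"
  proof (rule rel_interiorI_inner[OF convex_convex_hull mem])
    fix a y assume a: "\<And>y. y \<in> convex hull W \<Longrightarrow> a \<bullet> ?m \<le> a \<bullet> y" and y: "y \<in> convex hull W"
    have ge: "0 \<le> a \<bullet> w - a \<bullet> ?m" if "w \<in> W" for w
      using a[OF hull_inc[OF that]] by simp
    have "(\<Sum>w\<in>W. a \<bullet> w - a \<bullet> ?m) = a \<bullet> \<Sum>W - ?n * (a \<bullet> ?m)"
      by (simp add: sum_subtractf inner_sum_right)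
    also have "\<dots> = 0" using n by simp
    finally have "\<forall>w\<in>W. a \<bullet> w - a \<bullet> ?m = 0"
      using ge assms(1) by (subst (asm) sum_nonneg_eq_0_iff) auto
    then show "a \<bullet> y = a \<bullet> ?m"
      by (intro inner_eq_on_convex_hull[OF _ y]) auto
  qed
  then show ?thesis using n by (subst mem_rel_interior_scaled_iff) auto
qed

section \<open>Lattices and codegrees\<close>

lemma is_lattice_zero: "is_lattice M \<Longrightarrow> 0 \<in> M"
  unfolding is_lattice_def by (auto intro!: exI[of _ "\<lambda>_. 0"])

lemma is_lattice_add:
  assumes "is_lattice M" "x \<in> M" "y \<in> M"
  shows "x + y \<in> M"
proof -
  obtain B where B: "M = {(\<Sum>b\<in>B. real_of_int (c b) *\<^sub>R b) |c. True}"
    using assms(1) unfolding is_lattice_def by auto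
  obtain c d where "x = (\<Sum>b\<in>B. real_of_int (c b) *\<^sub>R b)" "y = (\<Sum>b\<in>B. real_of_int (d b) *\<^sub>R b)"
    using assms(2,3) B by auto
  then have "x + y = (\<Sum>b\<in>B. real_of_int (c b + d b) *\<^sub>R b)"
    by (simp add: sum.distrib scaleR_add_left)
  then show ?thesis unfolding B mem_Collect_eq by (intro exI[of _ "\<lambda>b. c b + d b"]) simp
qed

lemma is_lattice_uminus:
  assumes "is_lattice M" "x \<in> M"
  shows "- x \<in> M"
proof -
  obtain B where B: "M = {(\<Sum>b\<in>B. real_of_int (c b) *\<^sub>R b) |c. True}"
    using assms(1) unfolding is_lattice_def by auto
  obtain c where "x = (\<Sum>b\<in>B. real_of_int (c b) *\<^sub>R b)"
    using assms(2) B by auto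
  then have "- x = (\<Sum>b\<in>B. real_of_int (- c b) *\<^sub>R b)"
    by (simp add: sum_negf)
  then show ?thesis unfolding B mem_Collect_eq by (intro exI[of _ "\<lambda>b. - c b"]) simp
qed

lemma is_lattice_diff:
  assumes "is_lattice M" "x \<in> M" "y \<in> M"
  shows "x - y \<in> M"
  using is_lattice_add[OF assms(1,2) is_lattice_uminus[OF assms(1,3)]] by simp

lemma scaleR_nat_mem:
  fixes L :: "'a::real_vector set"
  assumes "0 \<in> L" "\<And>x y. x \<in> L \<Longrightarrow> y \<in> L \<Longrightarrow> x + y \<in> L" "x \<in> L"
  shows "real n *\<^sub>R x \<in> L"
  by (induction n) (use assms in \<open>auto simp: scaleR_add_left\<close>)

lemma codeg_attained:
  assumes "Q \<noteq> {}" "0 < k" "x \<in> L" "x \<in> rel_interior ((\<lambda>x. real k *\<^sub>R x) ` Q)"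
  shows "0 < codeg L Q" "codeg L Q \<le> k"
    "\<exists>x\<in>L. x \<in> rel_interior ((\<lambda>x. real (codeg L Q) *\<^sub>R x) ` Q)"
proof -
  let ?p = "\<lambda>k. 0 < k \<and> L \<inter> rel_interior ((\<lambda>x. real k *\<^sub>R x) ` Q) \<noteq> {}"
  have k: "?p k" using assms by auto
  have c: "codeg L Q = (LEAST k. ?p k)" using assms(1) by (simp add: codeg_def)
  show "codeg L Q \<le> k" unfolding c using k by (rule Least_le)
  show "0 < codeg L Q" "\<exists>x\<in>L. x \<in> rel_interior ((\<lambda>x. real (codeg L Q) *\<^sub>R x) ` Q)"
    using LeastI[of ?p, OF k] unfolding c by auto
qed

text \<open>The sum of the generators is a lattice point inside the \<open>card W\<close>-fold
  dilate, so the \<open>LEAST\<close> in \<open>codeg\<close> ranges over a nonempty set.\<close>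

lemma codeg_convex_hull_attained:
  fixes L :: "'a::euclidean_space set"
  assumes "0 \<in> L" "\<And>x y. x \<in> L \<Longrightarrow> y \<in> L \<Longrightarrow> x + y \<in> L"
    and "finite W" "W \<subseteq> L" "convex hull W \<noteq> {}"
  shows "0 < codeg L (convex hull W)"
    "\<exists>x\<in>L. x \<in> rel_interior ((\<lambda>x. real (codeg L (convex hull W)) *\<^sub>R x) ` (convex hull W))"
proof -
  have W: "W \<noteq> {}" using assms(5) by auto
  have "sum f W' \<in> L" if "finite W'" "f ` W' \<subseteq> L" for f :: "'a \<Rightarrow> 'a" and W'
    using that by (induction W') (use assms(1,2) in auto)
  then have "\<Sum>W \<in> L" using assms(3,4) by (metis image_ident)
  then show "0 < codeg L (convex hull W)"
    "\<exists>x\<in>L. x \<in> rel_interior ((\<lambda>x. real (codeg L (convex hull W)) *\<^sub>R x) ` (convex hull W))"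
    using codeg_attained[OF assms(5) _ _ sum_mem_rel_interior_convex_hull[OF assms(3) W]] W assms(3)
    by (auto simp: card_gt_0_iff)
qed

lemma codeg_linear_image:
  fixes f :: "'a::euclidean_space \<Rightarrow> 'b::euclidean_space"
  assumes "linear f" "inj f"
  shows "codeg (f ` L) (f ` Q) = codeg L Q"
proof -
  have "f ` L \<inter> rel_interior ((\<lambda>x. real k *\<^sub>R x) ` f ` Q) =
        f ` (L \<inter> rel_interior ((\<lambda>x. real k *\<^sub>R x) ` Q))" for k
  proof -
    have "(\<lambda>x. real k *\<^sub>R x) ` f ` Q = f ` (\<lambda>x. real k *\<^sub>R x) ` Q"
      using assms(1) by (auto simp: image_image linear_scale)
    then show ?thesis
      using rel_interior_injective_linear_image[of f] assms
      by (simp add: linear_conv_bounded_linear image_Int)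
  qed
  then show ?thesis by (simp add: codeg_def)
qed

text \<open>If \<open>r < r'\<close>, then \<open>m + (r' - r) w\<close> is an interior lattice point of \<open>r' Q\<close> for every vertex \<open>w\<close>,
  so \<open>Q\<close> has only one vertex.\<close>

lemma gorenstein_index_le:
  fixes L :: "'a::euclidean_space set"
  assumes "0 \<in> L" "\<And>x y. x \<in> L \<Longrightarrow> y \<in> L \<Longrightarrow> x + y \<in> L"
    and g: "gorenstein L r m Q" and g': "gorenstein L r' m' Q"
    and "x \<in> Q" "y \<in> Q" "x \<noteq> y"
  shows "r' \<le> r"
proof (rule ccontr)
  assume "\<not> r' \<le> r"
  then have lt: "r < r'" by simp
  obtain W where W: "W \<subseteq> L" "Q = convex hull W"
    using g unfolding gorenstein_def lattice_polytope_def by auto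
  have r: "0 < r" and m: "m \<in> L" "m \<in> rel_interior ((\<lambda>x. real r *\<^sub>R x) ` Q)"
    using g unfolding gorenstein_def by auto
  have c: "(1 / real r) *\<^sub>R m \<in> rel_interior Q"
    using m(2) r by (simp add: mem_rel_interior_scaled_iff)
  have eq: "m + real (r' - r) *\<^sub>R w = m'" if w: "w \<in> W" for w
  proof -
    \<comment> \<open>This point is the convex combination of the vertex \<open>w\<close> and the
      interior point \<open>m / r\<close> with weights \<open>1 - r / r'\<close> and
      \<open>r / r'\<close>.\<close>
    have "w - (real r / real r') *\<^sub>R (w - (1 / real r) *\<^sub>R m) \<in> rel_interior Q"
      using c w r lt W(2) by (intro rel_interior_convex_shrink) (auto simp: hull_inc)
    also have "w - (real r / real r') *\<^sub>R (w - (1 / real r) *\<^sub>R m) =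
        (1 / real r') *\<^sub>R (m + real (r' - r) *\<^sub>R w)"
      using r lt by (simp add: algebra_simps of_nat_diff diff_divide_distrib)
    finally have "m + real (r' - r) *\<^sub>R w \<in> rel_interior ((\<lambda>x. real r' *\<^sub>R x) ` Q)"
      using lt by (subst mem_rel_interior_scaled_iff) auto
    moreover have "m + real (r' - r) *\<^sub>R w \<in> L"
      using assms(1,2) m(1) w W(1) scaleR_nat_mem by (metis subsetD)
    ultimately show ?thesis using g' unfolding gorenstein_def by auto
  qed
  have "w = w'" if "w \<in> W" "w' \<in> W" for w w'
  proof -
    have "real (r' - r) *\<^sub>R w = real (r' - r) *\<^sub>R w'"
      using eq[OF that(1)] eq[OF that(2)] by (metis add_left_cancel)
    then show ?thesis using lt by simp
  qed
  moreover have "W \<noteq> {}" using W(2) assms(5) by auto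
  ultimately obtain w where "W = {w}" by blast
  then show False using assms(5-7) W(2) by simp
qed

text \<open>The index and interior point in \<open>irreducible_gorenstein\<close> are existentially
  quantified, so they have to be identified. Two distinct points are required: in rank 0 the single
  point is Gorenstein of every index.\<close>

lemma gorenstein_unique:
  fixes L :: "'a::euclidean_space set"
  assumes "0 \<in> L" "\<And>x y. x \<in> L \<Longrightarrow> y \<in> L \<Longrightarrow> x + y \<in> L"
    and "gorenstein L r m Q" "gorenstein L r' m' Q" "x \<in> Q" "y \<in> Q" "x \<noteq> y"
  shows "r' = r \<and> m' = m"
proof -
  have "r' = r"
    using gorenstein_index_le[OF assms(1,2,3,4)] gorenstein_index_le[OF assms(1,2,4,3)] assms(5-7)
    by (meson le_antisym)
  then show ?thesis using assms(3,4) unfolding gorenstein_def by auto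
qed

section \<open>Facet normals of a reflexive polytope\<close>

lemma reflexive_facet_normals:
  fixes M P :: "'a::euclidean_space set"
  assumes "reflexive M P"
  obtains U where "finite U" "U \<subseteq> dual_lattice M" "P = {x \<in> span M. \<forall>u\<in>U. u \<bullet> x \<le> 1}"
    "\<And>u. u \<in> U \<Longrightarrow> \<exists>x\<in>P. u \<bullet> x = 1"
proof -
  have aff: "affine hull P = span M" and zero: "0 \<in> rel_interior P"
    and fac: "\<And>F. F facet_of P \<Longrightarrow>
        \<exists>u. primitive (dual_lattice M) u \<and> affine hull F = {x \<in> span M. u \<bullet> x = 1}"
    and "lattice_polytope M P"
    using assms unfolding reflexive_def by auto
  then have pol: "polytope P"
    unfolding lattice_polytope_def polytope_def by auto
  obtain n where n: "\<And>F. F facet_of P \<Longrightarrow> primitive (dual_lattice M) (n F)"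
      "\<And>F. F facet_of P \<Longrightarrow> affine hull F = {x \<in> span M. n F \<bullet> x = 1}"
    using fac by metis
  have zP: "0 \<in> P" using zero rel_interior_subset by blast
  have PV: "P \<subseteq> span M" using aff hull_subset by metis
  have on: "n F \<bullet> x = 1" if "F facet_of P" "x \<in> F" for F x
    using n(2)[OF that(1)] that(2) hull_subset[of F affine] by auto
  have le: "n F \<bullet> x \<le> 1" if F: "F facet_of P" and x: "x \<in> P" for F x
  proof (rule ccontr)
    assume "\<not> n F \<bullet> x \<le> 1"
    then have gt: "n F \<bullet> x > 1" by simp
    obtain a b where ab: "F = P \<inter> {x. a \<bullet> x = b}"
      using facet_of_polyhedron[OF polytope_imp_polyhedron[OF pol] F] by metis
    \<comment> \<open>The segment from 0 to \<open>x\<close> meets the facet hyperplane at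
      \<open>?y\<close>, strictly between its ends. Then \<open>?y\<close> lies in \<open>F\<close>,
      and the face property forces 0 into \<open>F\<close>, where the normal has value 1.\<close>
    let ?y = "(1 / (n F \<bullet> x)) *\<^sub>R x"
    have ys: "?y \<in> open_segment 0 x"
      using gt by (auto simp: in_segment intro!: exI[of _ "1 / (n F \<bullet> x)"])
    have "?y \<in> P"
      using ys zP x polytope_imp_convex[OF pol] by (meson convex_contains_open_segment subsetD)
    moreover have "?y \<in> affine hull F"
      using gt PV x unfolding n(2)[OF F] by (auto intro: span_scale)
    moreover have "affine hull F \<subseteq> {x. a \<bullet> x = b}"
      using ab by (intro hull_minimal affine_hyperplane) auto
    ultimately have "?y \<in> F" using ab by auto
    then have "0 \<in> F"
      using F ys zP x unfolding facet_of_def face_of_def by blast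
    then show False using on[OF F] by force
  qed
  have sub: "x \<in> P" if x: "x \<in> span M" "\<And>F. F facet_of P \<Longrightarrow> n F \<bullet> x \<le> 1" for x
  proof (cases "x = 0")
    case False
    \<comment> \<open>The ray through \<open>x\<close> leaves \<open>P\<close> at
      \<open>d x\<close>, which lies on some facet. The inequality of that facet gives
      \<open>d \<ge> 1\<close>, so \<open>x\<close> lies between 0 and a point of
      \<open>P\<close>.\<close>
    obtain d where d: "0 < d" "0 + d *\<^sub>R x \<in> rel_frontier P"
      by (rule ray_to_rel_frontier[OF polytope_imp_bounded[OF pol] zero, of x])
         (use aff x(1) False in auto)
    then have "d *\<^sub>R x \<in> P - rel_interior P"
      using polytope_imp_closed[OF pol] by (simp add: rel_frontier_def)
    then obtain F where F: "F facet_of P" "d *\<^sub>R x \<in> F"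
      using rel_boundary_of_polyhedron[OF polytope_imp_polyhedron[OF pol]] by blast
    have "d * (n F \<bullet> x) = 1" using on[OF F] by simp
    then have "1 \<le> d"
      using x(2)[OF F(1)] d(1) by (metis mult_left_le order_less_imp_le)
    have "d *\<^sub>R x \<in> P" using F facet_of_imp_subset by blast
    then have "(1 / d) *\<^sub>R (d *\<^sub>R x) + (1 - 1 / d) *\<^sub>R 0 \<in> P"
      using zP \<open>1 \<le> d\<close> by (intro convexD[OF polytope_imp_convex[OF pol]]) auto
    then show ?thesis using d(1) by simp
  qed (use zP in simp)
  show ?thesis
  proof (rule that[of "n ` {F. F facet_of P}"])
    show "finite (n ` {F. F facet_of P})"
      using finite_polytope_facets[OF pol] by simp
    show "n ` {F. F facet_of P} \<subseteq> dual_lattice M"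
      using n(1) unfolding primitive_def by auto
    show "P = {x \<in> span M. \<forall>u\<in>n ` {F. F facet_of P}. u \<bullet> x \<le> 1}"
      using sub le PV by auto
    show "\<exists>x\<in>P. u \<bullet> x = 1" if "u \<in> n ` {F. F facet_of P}" for u
      using that on facet_of_imp_subset unfolding facet_of_def by (auto; blast)
  qed
qed

text \<open>This is the bipolar theorem inside the subspace \<open>V\<close>: a functional
  separating \<open>w\<close> from the hull, projected to \<open>V\<close> and rescaled, would be a
  point of the polar violating the bound.\<close>

lemma bounded_by_one_imp_in_convex_hull:
  fixes V U :: "'a::euclidean_space set"
  assumes "subspace V" "finite U" "U \<subseteq> V" "w \<in> V"
    and le: "\<And>x. x \<in> V \<Longrightarrow> (\<And>u. u \<in> U \<Longrightarrow> u \<bullet> x \<le> 1) \<Longrightarrow> w \<bullet> x \<le> 1"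
  shows "w \<in> convex hull (insert 0 U)"
proof (rule ccontr)
  assume "w \<notin> convex hull (insert 0 U)"
  then obtain a b where ab: "a \<bullet> w < b" "\<And>x. x \<in> convex hull (insert 0 U) \<Longrightarrow> b < a \<bullet> x"
    using separating_hyperplane_closed_point[of "convex hull (insert 0 U)" w] assms(2)
    by (auto simp: compact_imp_closed finite_imp_compact_convex_hull)
  have b: "b < 0" using ab(2)[of 0] by (simp add: hull_inc)
  obtain y z where yz: "y \<in> span V" "\<And>v. v \<in> span V \<Longrightarrow> orthogonal z v" "a = y + z"
    using orthogonal_subspace_decomp_exists[of V a] by metis
  have V: "span V = V" using assms(1) by (simp add: span_eq_iff)
  have ya: "y \<bullet> v = a \<bullet> v" if "v \<in> V" for v
    using yz(2)[of v] that V yz(3) by (simp add: orthogonal_def inner_add_left)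
  \<comment> \<open>As \<open>b\<close> is negative, dividing by it turns
    \<open>b < y \<bullet> u\<close> into \<open>u \<bullet> ?x < 1\<close> and
    \<open>y \<bullet> w < b\<close> into \<open>w \<bullet> ?x > 1\<close>.\<close>
  let ?x = "(1 / b) *\<^sub>R y"
  have "w \<bullet> ?x \<le> 1"
  proof (rule le)
    show "?x \<in> V" using yz(1) V assms(1) by (simp add: subspace_scale)
    fix u assume "u \<in> U"
    then have "b < y \<bullet> u" using ab(2)[of u] ya[of u] assms(3) by (auto simp: hull_inc)
    then show "u \<bullet> ?x \<le> 1" using b by (simp add: inner_commute field_simps)
  qed
  moreover have "y \<bullet> w < b" using ab(1) ya[OF assms(4)] by simp
  ultimately show False using b by (simp add: inner_commute field_simps)
qed

section \<open>Nef-partitions and their Cayley polytopes\<close>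

text \<open>Reflexivity enters only through \<open>U\<close>: finitely many integral functionals
  that cut out \<open>P\<close> by inequalities with right-hand side 1, each of them tight.\<close>

locale nef =
  fixes M P U :: "'a::euclidean_space set" and Ps :: "'r::finite \<Rightarrow> 'a set"
  assumes lattice: "is_lattice M"
    and lattice_polytope_Ps: "lattice_polytope M (Ps i)"
    and zero_Ps: "0 \<in> Ps i"
    and P_sum: "P = (\<Sum>i\<in>UNIV. Ps i)"
    and zero_interior: "0 \<in> rel_interior P"
    and affine_hull_P: "affine hull P = span M"
    and bounded_P: "bounded P"
    and finite_U: "finite U"
    and U_dual: "U \<subseteq> dual_lattice M"
    and P_eq: "P = {x \<in> span M. \<forall>u\<in>U. u \<bullet> x \<le> 1}"
    and U_tight: "u \<in> U \<Longrightarrow> \<exists>x\<in>P. u \<bullet> x = 1"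
begin

lemma max_Ps:
  obtains v where "v \<in> Ps i" "v \<in> M" "\<And>x. x \<in> Ps i \<Longrightarrow> w \<bullet> x \<le> w \<bullet> v"
proof -
  obtain W where W: "finite W" "W \<subseteq> M" "Ps i = convex hull W"
    using lattice_polytope_Ps unfolding lattice_polytope_def by metis
  then have "W \<noteq> {}" using zero_Ps[of i] by auto
  then show ?thesis
    using inner_max_on_convex_hull[OF W(1), of w] that W(2,3) hull_inc by (metis subsetD)
qed

section \<open>Support functions of the summands\<close>

definition h :: "'r \<Rightarrow> 'a \<Rightarrow> real" where
  "h i w = (SUP x\<in>Ps i. w \<bullet> x)"

lemma h_attained: "\<exists>v\<in>Ps i \<inter> M. h i w = w \<bullet> v"
proof -
  obtain v where v: "v \<in> Ps i" "v \<in> M" "\<And>x. x \<in> Ps i \<Longrightarrow> w \<bullet> x \<le> w \<bullet> v"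
    using max_Ps by metis
  have "h i w = w \<bullet> v"
    unfolding h_def by (rule cSup_eq_maximum) (use v in auto)
  then show ?thesis using v by blast
qed

lemma h_ge: "x \<in> Ps i \<Longrightarrow> w \<bullet> x \<le> h i w"
proof -
  assume x: "x \<in> Ps i"
  obtain v where v: "\<And>x. x \<in> Ps i \<Longrightarrow> w \<bullet> x \<le> w \<bullet> v"
    using max_Ps by metis
  show ?thesis unfolding h_def
    by (rule cSUP_upper[OF x]) (use v in \<open>auto simp: bdd_above_def\<close>)
qed

lemma h_le: "(\<And>x. x \<in> Ps i \<Longrightarrow> w \<bullet> x \<le> c) \<Longrightarrow> h i w \<le> c"
  using h_attained[of i w] by auto

lemma h_nonneg: "0 \<le> h i w"
  using h_ge[OF zero_Ps, of w i] by simp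

lemma sum_memI: "(\<And>i. i \<in> I \<Longrightarrow> s i \<in> Ps i) \<Longrightarrow> sum s I \<in> (\<Sum>i\<in>I. Ps i)"
  by (auto simp: set_sum_alt)

lemma sum_memE:
  assumes "x \<in> (\<Sum>i\<in>I. Ps i)"
  obtains s where "x = sum s I" "\<And>i. i \<in> I \<Longrightarrow> s i \<in> Ps i"
  using assms by (auto simp: set_sum_alt)

lemma Ps_subset_sum: "i \<in> I \<Longrightarrow> x \<in> Ps i \<Longrightarrow> x \<in> (\<Sum>i\<in>I. Ps i)"
  using sum_memI[of I "\<lambda>j. if j = i then x else 0"] zero_Ps by (simp add: sum.delta)

lemma Ps_subset_P: "x \<in> Ps i \<Longrightarrow> x \<in> P"
  using Ps_subset_sum[of i UNIV] unfolding P_sum by auto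

lemma P_subset_span: "P \<subseteq> span M"
  using affine_hull_P hull_subset by metis

lemma convex_Ps: "convex (Ps i)"
  using lattice_polytope_Ps[of i] unfolding lattice_polytope_def by auto

lemma convex_sum_Ps: "convex (\<Sum>i\<in>I. Ps i)"
  by (intro convex_set_sum convex_Ps)

lemma h_sum_ge: "x \<in> P \<Longrightarrow> w \<bullet> x \<le> (\<Sum>i\<in>UNIV. h i w)"
  unfolding P_sum by (erule sum_memE) (auto simp: inner_sum_right intro!: sum_mono h_ge)

lemma h_sum_attained: "\<exists>x\<in>P. (\<Sum>i\<in>UNIV. h i w) = w \<bullet> x"
proof -
  obtain s where s: "\<And>i. s i \<in> Ps i" "\<And>i. h i w = w \<bullet> s i"
    using h_attained[of _ w] by (metis IntD1)
  have "(\<Sum>i\<in>UNIV. h i w) = w \<bullet> sum s UNIV" using s(2) by (simp add: inner_sum_right)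
  moreover have "sum s UNIV \<in> P" unfolding P_sum by (rule sum_memI) (rule s)
  ultimately show ?thesis by blast
qed

text \<open>Support functions add up under Minkowski sums, and the support function of
  \<open>P\<close> equals 1 at a tight functional.\<close>

lemma h_sum_U:
  assumes "u \<in> U"
  shows "(\<Sum>i\<in>UNIV. h i u) = 1"
proof (rule antisym)
  obtain x where "x \<in> P" "(\<Sum>i\<in>UNIV. h i u) = u \<bullet> x" using h_sum_attained by blast
  then show "(\<Sum>i\<in>UNIV. h i u) \<le> 1" using P_eq assms by simp
  obtain x where "x \<in> P" "u \<bullet> x = 1" using U_tight[OF assms] by blast
  then show "1 \<le> (\<Sum>i\<in>UNIV. h i u)" using h_sum_ge[of x u] by simp
qed

text \<open>The functional attains its minimum over \<open>P\<close> at the interior point 0, so it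
  vanishes on \<open>P\<close> and on its affine hull \<open>span M\<close>.\<close>

lemma inner_nonneg_imp_zero:
  assumes "a \<in> span M" "\<And>x. x \<in> P \<Longrightarrow> 0 \<le> a \<bullet> x"
  shows "a = 0"
proof -
  have "convex P" unfolding P_sum by (rule convex_sum_Ps)
  then have "a \<bullet> x = 0" if "x \<in> P" for x
    using inner_eq_if_min_at_rel_interior[OF _ zero_interior, of a x] assms(2) that by simp
  then have "affine hull P \<subseteq> {x. a \<bullet> x = 0}"
    by (intro hull_minimal affine_hyperplane) auto
  then show ?thesis using assms(1) affine_hull_P by auto
qed

lemma inner_nonpos_imp_zero:
  assumes "x \<in> span M" "\<And>u. u \<in> U \<Longrightarrow> u \<bullet> x \<le> 0"
  shows "x = 0"
proof (rule ccontr)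
  assume "x \<noteq> 0"
  obtain B where B: "\<And>y. y \<in> P \<Longrightarrow> norm y \<le> B"
    using bounded_P unfolding bounded_iff by auto
  have B0: "0 \<le> B" using B[OF Ps_subset_P[OF zero_Ps]] by simp
  \<comment> \<open>With this factor the multiple of \<open>x\<close> has norm \<open>B + 1\<close>,
    beyond the bound for \<open>P\<close>, although it satisfies every inequality of
    \<open>P\<close>.\<close>
  let ?t = "(B + 1) / norm x"
  have "?t *\<^sub>R x \<in> P"
  proof -
    have "u \<bullet> (?t *\<^sub>R x) \<le> 0" if "u \<in> U" for u
      using assms(2)[OF that] B0 by (simp add: mult_nonneg_nonpos divide_nonpos_nonneg)
    then have "\<forall>u\<in>U. u \<bullet> (?t *\<^sub>R x) \<le> 1" by force
    then show ?thesis using assms(1) unfolding P_eq by (simp add: span_scale)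
  qed
  then show False using B[of "?t *\<^sub>R x"] \<open>x \<noteq> 0\<close> B0 by simp
qed

section \<open>The Cayley polytope and its dual in cone coordinates\<close>

abbreviation C :: "('a \<times> (real^'r)) set" where "C \<equiv> cayley_polytope Ps"

text \<open>\<open>C\<close> lies in the hyperplane of coordinate sum 1, so that sum already serves
  as the height of the cone over \<open>C\<close>. Thus \<open>lat\<close> plays the role of the
  cone lattice, with \<open>dlat\<close> as its dual.\<close>

definition lat :: "('a \<times> (real^'r)) set" where
  "lat = M \<times> {v. \<forall>i. v $ i \<in> \<int>}"

definition dlat :: "('a \<times> (real^'r)) set" where
  "dlat = dual_lattice M \<times> {v. \<forall>i. v $ i \<in> \<int>}"

text \<open>\<open>D\<close> is the dual Gorenstein polytope in the coordinates of the cone over \<open>C\<close>, where \<open>(0, 1)\<close>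
  is the interior lattice point of the \<open>r\<close>-fold dilate of \<open>C\<close>.\<close>

definition D :: "('a \<times> (real^'r)) set" where
  "D = {y. fst y \<in> span M \<and> (\<forall>z\<in>C. 0 \<le> y \<bullet> z) \<and> y \<bullet> (0, 1) = 1}"

lemma inner_one: "y \<bullet> (0, 1) = (\<Sum>i\<in>UNIV. snd y $ i)" for y :: "'a \<times> (real^'r)"
  by (cases y) (simp add: inner_vec_def)

lemma inner_axis_pair: "y \<bullet> (x, axis i c) = fst y \<bullet> x + c * snd y $ i" for y :: "'a \<times> (real^'r)"
  by (cases y) (simp add: inner_axis)

lemma inner_axis_pair': "(x, axis i c) \<bullet> y = x \<bullet> fst y + c * snd y $ i" for y :: "'a \<times> (real^'r)"
  by (simp add: inner_commute[of "(x, axis i c)"] inner_axis_pair) (simp add: inner_commute)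

lemma generator_mem: "x \<in> Ps i \<Longrightarrow> (x, axis i 1) \<in> C"
  unfolding cayley_polytope_def by (auto intro: hull_inc)

lemma inner_ge_on_C: "(\<And>i x. x \<in> Ps i \<Longrightarrow> c \<le> a \<bullet> (x, axis i 1)) \<Longrightarrow> z \<in> C \<Longrightarrow> c \<le> a \<bullet> z"
  unfolding cayley_polytope_def by (erule inner_ge_on_convex_hull[rotated]) auto

lemma inner_eq_on_C: "(\<And>i x. x \<in> Ps i \<Longrightarrow> a \<bullet> (x, axis i 1) = c) \<Longrightarrow> z \<in> C \<Longrightarrow> a \<bullet> z = c"
  unfolding cayley_polytope_def by (erule inner_eq_on_convex_hull[rotated]) auto

lemma C_coord_nonneg: "z \<in> C \<Longrightarrow> 0 \<le> snd z $ i"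
  using inner_ge_on_C[of 0 "(0, axis i 1)" z]
  unfolding inner_axis_pair inner_axis_pair' by (auto simp: axis_def)

lemma C_coord_sum: "z \<in> C \<Longrightarrow> (\<Sum>i\<in>UNIV. snd z $ i) = 1"
  using inner_eq_on_C[of "(0, 1)" 1 z]
  by (simp add: inner_axis_pair inner_commute[of "(0, 1)" z] inner_one)

lemma C_fst: "z \<in> C \<Longrightarrow> fst z \<in> span M"
proof -
  assume z: "z \<in> C"
  have "C \<subseteq> span M \<times> UNIV"
    unfolding cayley_polytope_def
    by (intro hull_minimal convex_Times) (use Ps_subset_P P_subset_span in
      \<open>auto simp: subspace_imp_convex\<close>)
  then show ?thesis using z by auto
qed

lemma convex_C: "convex C"
  unfolding cayley_polytope_def by simp

lemma C_nonempty: "C \<noteq> {}"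
  using generator_mem[OF zero_Ps] by auto

lemma C_generators:
  obtains W where "finite W" "W \<subseteq> (\<Union>i. (Ps i \<inter> M) \<times> {axis i 1})" "C = convex hull W"
proof -
  obtain V where V: "\<And>i. finite (V i)" "\<And>i. V i \<subseteq> M" "\<And>i. Ps i = convex hull (V i)"
    using lattice_polytope_Ps unfolding lattice_polytope_def by metis
  let ?W = "\<Union>i. V i \<times> {axis i (1::real)}"
  have "C \<subseteq> convex hull ?W"
    unfolding cayley_polytope_def
  proof (intro hull_minimal convex_convex_hull UN_least)
    fix i
    have "Ps i \<times> {axis i (1::real)} = convex hull (V i \<times> {axis i 1})"
      by (simp add: convex_hull_Times V(3))
    also have "\<dots> \<subseteq> convex hull ?W" by (intro hull_mono) auto
    finally show "Ps i \<times> {axis i (1::real)} \<subseteq> convex hull ?W" .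
  qed
  moreover have "convex hull ?W \<subseteq> C"
    unfolding cayley_polytope_def by (intro hull_mono) (auto simp: V(3) hull_inc)
  moreover have "?W \<subseteq> (\<Union>i. (Ps i \<inter> M) \<times> {axis i 1})"
  proof
    fix w assume "w \<in> ?W"
    then obtain i x where w: "w = (x, axis i 1)" "x \<in> V i" by auto
    then have "x \<in> Ps i \<inter> M" using V(2) by (auto simp: V(3) hull_inc)
    then show "w \<in> (\<Union>i. (Ps i \<inter> M) \<times> {axis i 1})" using w(1) by blast
  qed
  ultimately show ?thesis
    using that[of ?W] V(1) by auto
qed

lemma polytope_C: "polytope C"
  using C_generators unfolding polytope_def by metis

lemma face_generators:
  assumes "F face_of C"
  obtains W where "finite W" "W \<subseteq> (\<Union>i. (Ps i \<inter> M) \<times> {axis i 1})" "F = convex hull W"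
proof -
  obtain W where W: "finite W" "W \<subseteq> (\<Union>i. (Ps i \<inter> M) \<times> {axis i 1})" "C = convex hull W"
    by (rule C_generators)
  obtain W' where "W' \<subseteq> W" "F = convex hull W'"
    using face_of_convex_hull_subset[OF finite_imp_compact[OF W(1)]] assms W(3) by metis
  then show ?thesis using that[of W'] W finite_subset by blast
qed

lemma lat_zero: "0 \<in> lat" and lat_add: "x \<in> lat \<Longrightarrow> y \<in> lat \<Longrightarrow> x + y \<in> lat"
  using is_lattice_zero[OF lattice] is_lattice_add[OF lattice] by (auto simp: lat_def zero_prod_def)

lemma dlat_zero: "0 \<in> dlat" and dlat_add: "x \<in> dlat \<Longrightarrow> y \<in> dlat \<Longrightarrow> x + y \<in> dlat"
  by (auto simp: dlat_def dual_lattice_def span_zero span_add inner_add_left zero_prod_def)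

lemma lat_dlat_Ints: "y \<in> dlat \<Longrightarrow> z \<in> lat \<Longrightarrow> y \<bullet> z \<in> \<int>"
  by (auto simp: dlat_def lat_def dual_lattice_def inner_vec_def intro!: Ints_add Ints_sum Ints_mult)

lemma generators_lat: "(\<Union>i. (Ps i \<inter> M) \<times> {axis i 1}) \<subseteq> lat"
  by (auto simp: lat_def axis_def)

lemma pos_Ints_ge_1: "x \<in> \<int> \<Longrightarrow> 0 < x \<Longrightarrow> 1 \<le> x" for x :: real
  by (auto elim!: Ints_cases)

lemma convex_D: "convex D"
proof (rule convexI)
  fix x y :: "'a \<times> (real^'r)" and u v :: real
  assume *: "x \<in> D" "y \<in> D" "0 \<le> u" "0 \<le> v" "u + v = 1"
  then show "u *\<^sub>R x + v *\<^sub>R y \<in> D"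
    by (auto simp: D_def span_add span_scale inner_add_left simp del: inner_Pair)
qed

text \<open>Nonnegativity on \<open>C\<close> only has to be tested on the points
  \<open>(x, axis i 1)\<close>, and for fixed \<open>i\<close> the worst \<open>x\<close> gives the
  value of the support function.\<close>

lemma D_mem_iff:
  "y \<in> D \<longleftrightarrow> fst y \<in> span M \<and> (\<forall>i. h i (- fst y) \<le> snd y $ i) \<and> (\<Sum>i\<in>UNIV. snd y $ i) = 1"
proof -
  have "(\<forall>z\<in>C. 0 \<le> y \<bullet> z) \<longleftrightarrow> (\<forall>i. h i (- fst y) \<le> snd y $ i)"
  proof safe
    fix i assume "\<forall>z\<in>C. 0 \<le> y \<bullet> z"
    then have "0 \<le> y \<bullet> (x, axis i 1)" if "x \<in> Ps i" for x using that generator_mem by blast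
    then show "h i (- fst y) \<le> snd y $ i" by (intro h_le) (force simp: inner_axis_pair)
  next
    fix a b assume h: "\<forall>i. h i (- fst y) \<le> snd y $ i" and "(a, b) \<in> C"
    have "0 \<le> y \<bullet> (x, axis i 1)" if "x \<in> Ps i" for x i
      using h_ge[OF that, of "- fst y"] h[rule_format, of i] by (simp add: inner_axis_pair)
    then show "0 \<le> y \<bullet> (a, b)" using \<open>(a, b) \<in> C\<close> by (rule inner_ge_on_C)
  qed
  then show ?thesis by (auto simp: D_def inner_one)
qed

lemma D_nonneg: "y \<in> D \<Longrightarrow> z \<in> C \<Longrightarrow> 0 \<le> y \<bullet> z"
  by (simp add: D_def)

lemma D_coord_nonneg: "y \<in> D \<Longrightarrow> 0 \<le> snd y $ i"
  using h_nonneg[of i "- fst y"] by (auto simp: D_mem_iff intro: order_trans)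

section \<open>Integral generators of the dual polytope\<close>

definition T :: "('a \<times> (real^'r)) set" where
  "T = range (\<lambda>i. (0, axis i 1)) \<union> (\<lambda>u. (- u, \<chi> i. h i u)) ` U"

lemma finite_T: "finite T"
  unfolding T_def using finite_U by simp

lemma axis_mem_D: "(0, axis i 1) \<in> D"
proof -
  have "h j 0 = 0" for j using h_attained[of j 0] by auto
  then show ?thesis by (auto simp: D_mem_iff span_zero axis_def sum.delta)
qed

lemma T_subset_D: "T \<subseteq> D"
proof -
  have "(- u, \<chi> i. h i u) \<in> D" if "u \<in> U" for u
    using that U_dual h_sum_U by (auto simp: D_mem_iff dual_lattice_def span_neg)
  then show ?thesis using axis_mem_D by (auto simp: T_def)
qed

lemma h_Ints: "u \<in> dual_lattice M \<Longrightarrow> h i u \<in> \<int>"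
  using h_attained[of i u] by (auto simp: dual_lattice_def)

lemma T_subset_dlat: "T \<subseteq> dlat"
proof -
  have "(- u, \<chi> i. h i u) \<in> dlat" if "u \<in> U" for u
    using that U_dual h_Ints by (auto simp: dlat_def dual_lattice_def span_neg)
  moreover have "(0, axis i 1) \<in> dlat" for i
    by (auto simp: dlat_def dual_lattice_def axis_def span_zero)
  ultimately show ?thesis by (auto simp: T_def)
qed

text \<open>For \<open>w\<close> with \<open>\<Sum>i. h i w = 1\<close>, any lift \<open>(-w, b)\<close> of \<open>w\<close> into the convex hull of \<open>T\<close> has
  \<open>b i \<ge> h i w\<close> with both sides summing to 1, hence is \<open>(-w, h w)\<close>.\<close>

lemma support_vector_mem:
  assumes "w \<in> span M" "(\<Sum>i\<in>UNIV. h i w) = 1"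
  shows "(- w, \<chi> i. h i w) \<in> convex hull T"
proof -
  have "w \<in> convex hull (insert 0 U)"
  proof (rule bounded_by_one_imp_in_convex_hull[OF subspace_span[of M] finite_U _ assms(1)])
    show "U \<subseteq> span M" using U_dual by (auto simp: dual_lattice_def)
    show "w \<bullet> x \<le> 1" if "x \<in> span M" "\<And>u. u \<in> U \<Longrightarrow> u \<bullet> x \<le> 1" for x
      using h_sum_ge[of x w] that assms(2) P_eq by auto
  qed
  also have "insert 0 U \<subseteq> (\<lambda>y. - fst y) ` insert 0 T"
    by (force simp: T_def image_iff)
  then have "convex hull (insert 0 U) \<subseteq> convex hull ((\<lambda>y. - fst y) ` insert 0 T)"
    by (rule hull_mono)
  also have "\<dots> = (\<lambda>y. - fst y) ` (convex hull (insert 0 T))"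
    by (rule convex_hull_linear_image[symmetric])
       (auto intro!: linearI simp: algebra_simps)
  finally obtain y where y: "y \<in> convex hull (insert 0 T)" "w = - fst y" by auto
  have "T \<noteq> {}" by (auto simp: T_def)
  \<comment> \<open>The inserted origin takes the weight \<open>a\<close>. What remains is
    \<open>c\<close> times a point of the hull of \<open>T\<close>, and the coordinate sum
    \<open>c\<close> will be forced to be 1.\<close>
  then obtain a c t where t: "0 \<le> a" "0 \<le> c" "a + c = 1" "t \<in> convex hull T" "y = c *\<^sub>R t"
    using y(1) unfolding convex_hull_insert[OF \<open>T \<noteq> {}\<close>] by force
  have tD: "t \<in> D" using t(4) hull_minimal[of T D convex] T_subset_D convex_D by auto
  have ysum: "(\<Sum>i\<in>UNIV. snd y $ i) = c"
    using tD t(5) by (simp add: D_mem_iff sum_distrib_left[symmetric])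
  have hle: "h i w \<le> snd y $ i" for i
  proof (rule h_le)
    fix x assume "x \<in> Ps i"
    then have "0 \<le> t \<bullet> (x, axis i 1)" using tD D_nonneg generator_mem by blast
    then have "0 \<le> c * (t \<bullet> (x, axis i 1))" using t(2) by simp
    then have "0 \<le> y \<bullet> (x, axis i 1)" by (simp add: t(5) del: inner_Pair)
    then show "w \<bullet> x \<le> snd y $ i" by (simp add: inner_axis_pair y(2))
  qed
  have "1 \<le> c" using sum_mono[of UNIV "\<lambda>i. h i w" "\<lambda>i. snd y $ i"] hle assms(2) ysum by simp
  then have c: "c = 1" using t(1,3) by simp
  have "(\<Sum>i\<in>UNIV. snd y $ i - h i w) = 0"
    using assms(2) ysum c by (simp add: sum_subtractf)
  then have "\<forall>i. snd y $ i - h i w = 0"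
    using hle by (subst (asm) sum_nonneg_eq_0_iff) auto
  then have "(- w, \<chi> i. h i w) = t"
    using y(2) t(5) c by (auto simp: prod_eq_iff vec_eq_iff)
  then show ?thesis using t(4) by simp
qed

text \<open>A point \<open>(-w, b)\<close> of \<open>D\<close> splits into \<open>(-w, h w)\<close>
  and the nonnegative slack \<open>b - h w\<close>. The former is \<open>s\<close> times a point of
  the hull of \<open>T\<close> by homogeneity of \<open>h\<close>, the latter a combination of
  coordinate functionals, and all weights sum to 1.\<close>

lemma D_eq: "D = convex hull T"
proof
  show "convex hull T \<subseteq> D" using T_subset_D convex_D by (rule hull_minimal)
  show "D \<subseteq> convex hull T"
  proof
    fix y assume y: "y \<in> D"
    define w where "w = - fst y"
    have w: "w \<in> span M" using y by (simp add: D_def w_def span_neg)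
    define s where "s = (\<Sum>i\<in>UNIV. h i w)"
    have s0: "0 \<le> s" unfolding s_def by (intro sum_nonneg) (rule h_nonneg)
    have "\<exists>t\<in>convex hull T. s *\<^sub>R t = (- w, \<chi> i. h i w)"
    proof (cases "s = 0")
      case True
      then have "\<forall>i. h i w = 0"
        using h_nonneg unfolding s_def by (subst (asm) sum_nonneg_eq_0_iff) auto
      moreover have "- w = 0"
      proof (rule inner_nonneg_imp_zero)
        show "- w \<in> span M" using w by (simp add: span_neg)
        show "0 \<le> - w \<bullet> x" if "x \<in> P" for x
          using h_sum_ge[OF that, of w] True s_def by simp
      qed
      moreover have "(0, axis (undefined::'r) 1) \<in> convex hull T"
        by (intro hull_inc) (auto simp: T_def)
      ultimately show ?thesis using True by (intro bexI) (auto simp: vec_eq_iff prod_eq_iff)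
    next
      case False
      then have s: "s > 0" using s0 by simp
      have hs: "h i ((1 / s) *\<^sub>R w) = h i w / s" for i
      proof (rule antisym)
        show "h i ((1 / s) *\<^sub>R w) \<le> h i w / s"
          by (rule h_le) (use h_ge s in \<open>auto simp: divide_right_mono\<close>)
        obtain v where "v \<in> Ps i" "h i w = w \<bullet> v" using h_attained[of i w] by blast
        then show "h i w / s \<le> h i ((1 / s) *\<^sub>R w)"
          using h_ge[of v i "(1 / s) *\<^sub>R w"] by simp
      qed
      have "(- ((1 / s) *\<^sub>R w), \<chi> i. h i ((1 / s) *\<^sub>R w)) \<in> convex hull T"
        by (rule support_vector_mem)
           (use w s in \<open>auto simp: span_scale hs sum_divide_distrib[symmetric] s_def[symmetric]\<close>)
      then show ?thesis
        using s by (intro bexI) (auto simp: prod_eq_iff vec_eq_iff hs)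
    qed
    then obtain t where t: "t \<in> convex hull T" "s *\<^sub>R t = (- w, \<chi> i. h i w)" by blast
    define c where "c i = snd y $ i - h i w" for i
    have c: "0 \<le> c i" for i using y by (simp add: D_mem_iff c_def w_def)
    have sc: "s + (\<Sum>i\<in>UNIV. c i) = 1"
      using y by (simp add: D_mem_iff c_def s_def sum_subtractf)
    let ?a = "case_option s c" and ?p = "case_option t (\<lambda>i. (0, axis i 1))"
    have split: "(\<Sum>j\<in>UNIV. f j) = f None + (\<Sum>i\<in>UNIV. f (Some i))"
      for f :: "'r option \<Rightarrow> 'b::comm_monoid_add"
      by (simp add: UNIV_option_conv sum.reindex)
    have "(\<Sum>j\<in>UNIV. ?a j *\<^sub>R ?p j) \<in> convex hull T"
    proof (rule convex_sum)
      show "sum ?a UNIV = 1" using sc by (simp add: split)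
      show "0 \<le> ?a j" for j using s0 c by (simp split: option.split)
      show "?p j \<in> convex hull T" for j
        using t(1) by (auto simp: T_def split: option.split intro: hull_inc)
    qed auto
    also have "(\<Sum>j\<in>UNIV. ?a j *\<^sub>R ?p j) = y"
    proof -
      have "(\<Sum>i\<in>UNIV. c i *\<^sub>R axis i (1::real)) = (\<chi> i. c i)"
        by (auto simp: vec_eq_iff axis_def if_distrib cong: if_cong)
      then show ?thesis
        by (auto simp: split t(2) prod_eq_iff vec_eq_iff w_def c_def fst_sum snd_sum)
    qed
    finally show "y \<in> convex hull T" .
  qed
qed


definition coord_face :: "'r set \<Rightarrow> ('a \<times> (real^'r)) set" where
  "coord_face I = {z \<in> C. \<forall>j. j \<notin> I \<longrightarrow> snd z $ j = 0}"

definition ind :: "'r set \<Rightarrow> 'a \<times> (real^'r)" where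
  "ind I = (0, \<chi> i. of_bool (i \<in> I))"

lemma ind_UNIV: "ind UNIV = (0, 1)"
  by (simp add: ind_def vec_eq_iff)

lemma inner_ind: "ind I \<bullet> y = (\<Sum>i\<in>I. snd y $ i)"
  by (cases y) (simp add: ind_def inner_vec_def sum.If_cases of_bool_def if_distrib[of "\<lambda>x. x * _"] cong: if_cong)

lemma ind_lat: "ind I \<in> lat" and ind_dlat: "ind I \<in> dlat"
  using is_lattice_zero[OF lattice] by (auto simp: ind_def lat_def dlat_def dual_lattice_def span_zero)

lemma ind_eq_sum: "ind I = (\<Sum>i\<in>I. (0, axis i 1))"
  by (auto simp: ind_def prod_eq_iff vec_eq_iff fst_sum snd_sum axis_def of_bool_def)

lemma ind_mem_scaled:
  assumes "I \<noteq> {}" "convex S" "\<And>i. i \<in> I \<Longrightarrow> (0, axis i 1) \<in> S"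
  shows "(1 / real (card I)) *\<^sub>R ind I \<in> S"
proof -
  have "(1 / real (card I)) *\<^sub>R ind I = (\<Sum>i\<in>I. (1 / real (card I)) *\<^sub>R (0, axis i 1))"
    by (simp add: ind_eq_sum scaleR_sum_right)
  also have "\<dots> \<in> S" using assms by (intro convex_sum) auto
  finally show ?thesis .
qed

lemma coord_face_of_C: "coord_face I face_of C"
proof -
  have *: "snd z $ i \<ge> 0" if "z \<in> C" for z i using that C_coord_nonneg by simp
  have "coord_face I = C \<inter> {z. ind (- I) \<bullet> z = 0}"
    using * by (auto simp: coord_face_def inner_ind sum_nonneg_eq_0_iff simp del: inner_Pair)
  also have "\<dots> face_of C"
    using * by (intro face_of_Int_supporting_hyperplane_ge convex_C)
      (auto simp: inner_ind intro!: sum_nonneg)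
  finally show ?thesis .
qed

lemma coord_face_UNIV: "coord_face UNIV = C"
  by (simp add: coord_face_def)

lemma generator_mem_coord_face_iff: "x \<in> Ps i \<Longrightarrow> (x, axis i 1) \<in> coord_face I \<longleftrightarrow> i \<in> I"
  using generator_mem by (auto simp: coord_face_def axis_def)

lemma inner_ge_on_face:
  assumes "F face_of C" "\<And>i x. x \<in> Ps i \<Longrightarrow> (x, axis i 1) \<in> F \<Longrightarrow> c \<le> a \<bullet> (x, axis i 1)" "z \<in> F"
  shows "c \<le> a \<bullet> z"
proof -
  obtain W where W: "W \<subseteq> (\<Union>i. (Ps i \<inter> M) \<times> {axis i 1})" "F = convex hull W"
    by (rule face_generators[OF assms(1)])
  show ?thesis
  proof (rule inner_ge_on_convex_hull)
    show "z \<in> convex hull W" using assms(3) W(2) by simp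
    fix w assume w: "w \<in> W"
    then have "w \<in> F" using W(2) by (simp add: hull_inc)
    then show "c \<le> a \<bullet> w" using w W(1) assms(2) by auto
  qed
qed

lemma inner_eq_on_face:
  assumes "F face_of C" "\<And>i x. x \<in> Ps i \<Longrightarrow> (x, axis i 1) \<in> F \<Longrightarrow> a \<bullet> (x, axis i 1) = c" "z \<in> F"
  shows "a \<bullet> z = c"
proof -
  have "c \<le> a \<bullet> z" by (rule inner_ge_on_face[OF assms(1) _ assms(3)]) (use assms(2) in force)
  moreover have "- c \<le> (- a) \<bullet> z"
    by (rule inner_ge_on_face[OF assms(1) _ assms(3)]) (use assms(2) in force)
  ultimately show ?thesis by simp
qed

lemma ind_mem_rel_interior:
  assumes "I \<noteq> {}" "0 \<in> rel_interior (\<Sum>i\<in>I. Ps i)"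
  shows "ind I \<in> rel_interior ((\<lambda>x. real (card I) *\<^sub>R x) ` coord_face I)"
proof -
  let ?n = "real (card I)"
  have n: "?n > 0" using assms(1) by (simp add: card_gt_0_iff)
  let ?m = "(1 / ?n) *\<^sub>R ind I"
  have conv: "convex (coord_face I)" using coord_face_of_C face_of_imp_convex by blast
  have mem: "?m \<in> coord_face I"
    using assms(1) conv by (intro ind_mem_scaled) (auto simp: generator_mem_coord_face_iff zero_Ps)
  have "?m \<in> rel_interior (coord_face I)"
  proof (rule rel_interiorI_inner[OF conv mem])
    fix a z assume a: "\<And>y. y \<in> coord_face I \<Longrightarrow> a \<bullet> ?m \<le> a \<bullet> y" and z: "z \<in> coord_face I"
    have ge: "a \<bullet> ?m \<le> fst a \<bullet> x + snd a $ i" if "i \<in> I" "x \<in> Ps i" for i x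
      using a[of "(x, axis i 1)"] that generator_mem_coord_face_iff[of x i I]
      by (simp add: inner_axis_pair del: inner_Pair)
    have "a \<bullet> ?m = (\<Sum>i\<in>I. snd a $ i) / ?n"
      by (simp add: inner_commute[of a "ind I"] inner_ind)
    then have "(\<Sum>i\<in>I. snd a $ i - a \<bullet> ?m) = 0"
      using n by (simp add: sum_subtractf del: inner_scaleR_right)
    then have eq: "snd a $ i = a \<bullet> ?m" if "i \<in> I" for i
      using ge[OF _ zero_Ps] that by (subst (asm) sum_nonneg_eq_0_iff) auto
    have pos: "0 \<le> fst a \<bullet> x" if "x \<in> (\<Sum>i\<in>I. Ps i)" for x
      using that by (rule sum_memE) (use ge eq in \<open>force simp: inner_sum_right intro!: sum_nonneg\<close>)
    have "fst a \<bullet> x = 0" if "x \<in> (\<Sum>i\<in>I. Ps i)" for x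
      using inner_eq_if_min_at_rel_interior[OF convex_sum_Ps assms(2) _ that, of "fst a"] pos by simp
    then have "fst a \<bullet> x = 0" if "i \<in> I" "x \<in> Ps i" for i x
      using Ps_subset_sum[OF that] by simp
    then show "a \<bullet> z = a \<bullet> ?m"
      using eq by (intro inner_eq_on_face[OF coord_face_of_C _ z])
        (auto simp: generator_mem_coord_face_iff inner_axis_pair simp del: inner_Pair)
  qed
  then show ?thesis using n by (subst mem_rel_interior_scaled_iff) auto
qed

lemma one_mem_rel_interior: "(0, 1) \<in> rel_interior ((\<lambda>x. real CARD('r) *\<^sub>R x) ` C)"
  using ind_mem_rel_interior[of UNIV] zero_interior
  by (simp add: coord_face_UNIV ind_UNIV P_sum[symmetric])

lemma proper_face_exposed:
  assumes "F face_of C" "F \<noteq> C"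
  obtains y where "y \<in> D" "F = {z \<in> C. y \<bullet> z = 0}"
proof -
  have "F exposed_face_of C"
    using assms(1) exposed_face_of_polyhedron[OF polytope_imp_polyhedron[OF polytope_C]] by blast
  then obtain a b where ab: "C \<subseteq> {x. a \<bullet> x \<le> b}" "F = C \<inter> {x. a \<bullet> x = b}"
    unfolding exposed_face_of_def by auto
  obtain a1 a2 where a: "a1 \<in> span M" "\<And>v. v \<in> span M \<Longrightarrow> orthogonal a2 v" "fst a = a1 + a2"
    using orthogonal_subspace_decomp_exists[of M "fst a"] by metis
  define y :: "'a \<times> (real^'r)" where "y = (- a1, \<chi> i. b - snd a $ i)"
  have y: "y \<bullet> z = b - a \<bullet> z" if "z \<in> C" for z
  proof -
    have "fst a \<bullet> fst z = a1 \<bullet> fst z"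
      using a(2)[OF C_fst[OF that]] a(3) by (simp add: orthogonal_def inner_add_left)
    moreover have "(\<Sum>i\<in>UNIV. (b - snd a $ i) * snd z $ i) = b - snd a \<bullet> snd z"
      using C_coord_sum[OF that]
      by (simp add: left_diff_distrib sum_subtractf inner_vec_def sum_distrib_left[symmetric])
    ultimately show ?thesis
      by (simp add: y_def inner_prod_def inner_vec_def)
  qed
  have nonneg: "0 \<le> y \<bullet> z" if "z \<in> C" for z using y[OF that] ab(1) that by auto
  have F: "F = {z \<in> C. y \<bullet> z = 0}" using ab(2) y by auto
  obtain z where z: "z \<in> C" "y \<bullet> z \<noteq> 0" using F assms(2) by auto
  have s: "0 < y \<bullet> (0, 1)"
    by (rule inner_pos_at_rel_interior_scaled[OF convex_C _ one_mem_rel_interior nonneg z]) simp_all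
  let ?y = "(1 / (y \<bullet> (0, 1))) *\<^sub>R y"
  have "?y \<in> D"
    using s a(1) nonneg
    by (auto simp: D_def span_neg span_scale y_def[THEN arg_cong, of fst] simp del: inner_Pair)
  moreover have "F = {z \<in> C. ?y \<bullet> z = 0}" using F s by (auto simp del: inner_Pair)
  ultimately show ?thesis using that by blast
qed

lemma T_vanishing:
  assumes "y \<in> D"
  obtains t where "t \<in> T" "\<And>z. z \<in> C \<Longrightarrow> y \<bullet> z = 0 \<Longrightarrow> t \<bullet> z = 0"
proof -
  obtain l where l: "\<And>t. t \<in> T \<Longrightarrow> 0 \<le> l t" "sum l T = 1" "(\<Sum>t\<in>T. l t *\<^sub>R t) = y"
    using assms unfolding D_eq by (auto simp: convex_hull_finite[OF finite_T])
  obtain t where t: "t \<in> T" "l t \<noteq> 0" using l(2) by (metis sum.neutral zero_neq_one)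
  have "t \<bullet> z = 0" if z: "z \<in> C" "y \<bullet> z = 0" for z
  proof -
    have "(\<Sum>t\<in>T. l t * (t \<bullet> z)) = 0"
      using z(2) unfolding l(3)[symmetric] by (simp add: inner_sum_left)
    then have "l t * (t \<bullet> z) = 0"
      using sum_nonneg_eq_0_iff[OF finite_T, of "\<lambda>t. l t * (t \<bullet> z)"]
        l(1) T_subset_D D_nonneg z(1) t(1)
      by (meson mult_nonneg_nonneg subsetD)
    then show ?thesis using t(2) by simp
  qed
  then show ?thesis using that t(1) by blast
qed

lemma fst_zero_of_interior_lattice_point:
  assumes "S \<subseteq> C" "convex S" "0 < k" "x \<in> lat" "x \<in> rel_interior ((\<lambda>x. k *\<^sub>R x) ` S)"
    and "\<And>i. snd x $ i \<le> 1" "\<And>i. snd x $ i \<noteq> 0 \<Longrightarrow> (0, axis i 1) \<in> S"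
  shows "fst x = 0"
proof (rule inner_nonpos_imp_zero)
  show "fst x \<in> span M" using assms(4) by (auto simp: lat_def span_base)
  fix u assume u: "u \<in> U"
  let ?t = "(- u, \<chi> i. h i u) :: 'a \<times> (real^'r)"
  have t: "?t \<in> T" using u by (auto simp: T_def)
  have tx: "?t \<bullet> x = (\<Sum>i\<in>UNIV. h i u * snd x $ i) - u \<bullet> fst x"
    by (cases x) (simp add: inner_vec_def)
  show "u \<bullet> fst x \<le> 0"
  proof (cases "\<forall>z\<in>S. ?t \<bullet> z = 0")
    case True
    have hx: "h i u * snd x $ i = 0" for i
    proof (cases "snd x $ i = 0")
      case False
      then have "?t \<bullet> (0, axis i 1) = 0" using True assms(7) by blast
      then show ?thesis by (simp add: inner_axis)
    qed simp
    have "?t \<bullet> x = 0"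
    proof -
      obtain z where "z \<in> S" "x = k *\<^sub>R z" using assms(5) rel_interior_subset by blast
      then show ?thesis using True by simp
    qed
    then show ?thesis unfolding tx hx by simp
  next
    case False
    then obtain z where z: "z \<in> S" "?t \<bullet> z \<noteq> 0" by blast
    have "0 < ?t \<bullet> x"
      by (rule inner_pos_at_rel_interior_scaled[OF assms(2,3,5) _ z])
         (use t T_subset_D D_nonneg assms(1) in blast)
    then have "1 \<le> ?t \<bullet> x"
      using t T_subset_dlat lat_dlat_Ints assms(4) pos_Ints_ge_1 by blast
    moreover have "(\<Sum>i\<in>UNIV. h i u * snd x $ i) \<le> (\<Sum>i\<in>UNIV. h i u)"
      using assms(6) h_nonneg by (intro sum_mono) (simp add: mult_left_le)
    ultimately show ?thesis using tx h_sum_U[OF u] by simp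
  qed
qed

lemma coord_ge_1:
  assumes "S \<subseteq> C" "convex S" "0 < k" "x \<in> lat" "x \<in> rel_interior ((\<lambda>x. k *\<^sub>R x) ` S)"
    and "z \<in> S" "snd z $ i \<noteq> 0"
  shows "1 \<le> snd x $ i"
proof -
  have "0 < (0, axis i 1) \<bullet> x"
  proof (rule inner_pos_at_rel_interior_scaled[OF assms(2,3,5) _ assms(6)])
    show "0 \<le> (0, axis i 1) \<bullet> z" if "z \<in> S" for z
      using C_coord_nonneg[of z i] assms(1) that by (simp add: subsetD inner_axis_pair' del: inner_Pair)
    show "(0, axis i 1) \<bullet> z \<noteq> 0" using assms(7) by (simp add: inner_axis_pair' del: inner_Pair)
  qed
  then have "0 < snd x $ i" by (simp add: inner_axis_pair' del: inner_Pair)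
  then show ?thesis using assms(4) by (intro pos_Ints_ge_1) (auto simp: lat_def)
qed

lemma scaled_coord_sum:
  assumes "S \<subseteq> C" "x \<in> rel_interior ((\<lambda>x. k *\<^sub>R x) ` S)"
  shows "(\<Sum>i\<in>UNIV. snd x $ i) = k"
proof -
  obtain z where "z \<in> S" "x = k *\<^sub>R z" using assms(2) rel_interior_subset by blast
  then show ?thesis using C_coord_sum[of z] assms(1) by (auto simp: sum_distrib_left[symmetric])
qed

lemma interior_lattice_point_unique:
  assumes "x \<in> lat" "x \<in> rel_interior ((\<lambda>x. real CARD('r) *\<^sub>R x) ` C)"
  shows "x = (0, 1)"
proof -
  have ge: "1 \<le> snd x $ i" for i
    using coord_ge_1[OF subset_refl convex_C _ assms generator_mem[OF zero_Ps[of i]]] by simp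
  have "(\<Sum>i\<in>UNIV. snd x $ i - 1) = 0"
    using scaled_coord_sum[OF subset_refl assms(2)] by (simp add: sum_subtractf)
  then have eq: "snd x $ i = 1" for i
    using ge by (subst (asm) sum_nonneg_eq_0_iff) auto
  have "fst x = 0"
    by (rule fst_zero_of_interior_lattice_point[OF subset_refl convex_C _ assms])
       (auto simp: eq generator_mem zero_Ps)
  then show ?thesis using eq by (simp add: prod_eq_iff vec_eq_iff)
qed


section \<open>The Cayley polytope is Gorenstein\<close>

definition L0 :: "('a \<times> (real^'r)) set" where
  "L0 = M \<times> {v. (\<forall>i. v $ i \<in> \<int>) \<and> (\<Sum>i\<in>UNIV. v $ i) = 0}"

abbreviation R :: "('a \<times> (real^'r)) set" where
  "R \<equiv> (\<lambda>z. real CARD('r) *\<^sub>R z - (0, 1)) ` C"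

lemma affinity_image:
  "(\<lambda>z. c *\<^sub>R z - v) ` S = (+) (- v) ` ((\<lambda>x. c *\<^sub>R x) ` S)" for v :: "'b::real_vector"
  by (simp add: image_image)

lemma L0_zero: "0 \<in> L0" and L0_add: "x \<in> L0 \<Longrightarrow> y \<in> L0 \<Longrightarrow> x + y \<in> L0"
  using is_lattice_zero[OF lattice] is_lattice_add[OF lattice]
  by (auto simp: L0_def zero_prod_def sum.distrib)

lemma mem_L0_iff: "z \<in> L0 \<longleftrightarrow> z \<in> lat \<and> (\<Sum>i\<in>UNIV. snd z $ i) = 0"
  by (auto simp: L0_def lat_def)

lemma span_L0: "span L0 = span M \<times> {v. (\<Sum>i\<in>UNIV. v $ i) = 0}"
proof
  have "subspace {v :: real^'r. (\<Sum>i\<in>UNIV. v $ i) = 0}"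
    by (auto simp: subspace_def sum.distrib sum_distrib_left[symmetric])
  then show "span L0 \<subseteq> span M \<times> {v. (\<Sum>i\<in>UNIV. v $ i) = 0}"
    by (intro span_minimal subspace_Times subspace_span) (auto simp: L0_def span_base)
  show "span M \<times> {v. (\<Sum>i\<in>UNIV. v $ i) = 0} \<subseteq> span L0"
  proof clarify
    fix x :: 'a and v :: "real^'r"
    assume x: "x \<in> span M" and v: "(\<Sum>i\<in>UNIV. v $ i) = 0"
    have "(x, 0) \<in> span (M \<times> {0::real^'r})"
      using x by (simp add: span_Times_sing2)
    also have "\<dots> \<subseteq> span L0" by (intro span_mono) (auto simp: L0_def)
    finally have x0: "(x, 0) \<in> span L0" .
    let ?e = "\<lambda>i. axis i 1 - axis undefined 1 :: real^'r"
    have "v = (\<Sum>i\<in>UNIV. v $ i *\<^sub>R ?e i)"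
    proof -
      have "(\<Sum>i\<in>UNIV. v $ i *\<^sub>R ?e i) =
          (\<Sum>i\<in>UNIV. v $ i *\<^sub>R axis i 1) - (\<Sum>i\<in>UNIV. v $ i) *\<^sub>R axis undefined 1"
        by (simp add: scaleR_diff_right sum_subtractf scaleR_sum_left)
      also have "\<dots> = v"
        unfolding v by (auto simp: vec_eq_iff axis_def if_distrib cong: if_cong)
      finally show ?thesis by simp
    qed
    then have "(0, v) = (\<Sum>i\<in>UNIV. v $ i *\<^sub>R (0, ?e i))"
      by (auto simp: prod_eq_iff fst_sum snd_sum)
    moreover have "(0, ?e i) \<in> L0" for i
      using is_lattice_zero[OF lattice] by (auto simp: L0_def axis_def sum_subtractf)
    ultimately have "(0, v) \<in> span L0"
      by (metis (no_types, lifting) span_base span_scale span_sum)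
    then have "(x, 0) + (0, v) \<in> span L0" using x0 by (rule span_add[rotated])
    then show "(x, v) \<in> span L0" by simp
  qed
qed

lemma lat_minus_one_mem:
  assumes "z \<in> lat" "z \<in> C"
  shows "real CARD('r) *\<^sub>R z - (0, 1) \<in> L0"
proof -
  have "real CARD('r) *\<^sub>R z \<in> lat" using scaleR_nat_mem[of lat z] lat_zero lat_add assms(1) by blast
  then show ?thesis
    using C_coord_sum[OF assms(2)]
    by (cases z) (auto simp: L0_def lat_def sum_subtractf sum_distrib_left[symmetric])
qed

lemma lattice_polytope_R: "lattice_polytope L0 R"
proof -
  obtain W where W: "finite W" "W \<subseteq> (\<Union>i. (Ps i \<inter> M) \<times> {axis i 1})" "C = convex hull W"
    by (rule C_generators)
  let ?f = "\<lambda>z. real CARD('r) *\<^sub>R z - (0, 1)"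
  have "R = convex hull (?f ` W)"
    unfolding W(3) affinity_image convex_hull_translation convex_hull_scaling ..
  moreover have "?f ` W \<subseteq> L0"
    using W(2,3) generators_lat lat_minus_one_mem by (auto simp: hull_inc subset_iff)
  ultimately show ?thesis unfolding lattice_polytope_def using W(1) by blast
qed

lemma zero_mem_rel_interior_R: "0 \<in> rel_interior R"
proof -
  have "rel_interior R = (+) (- (0, 1)) ` rel_interior ((\<lambda>x. real CARD('r) *\<^sub>R x) ` C)"
    unfolding affinity_image by (rule rel_interior_translation)
  then have "- (0, 1) + (0, 1) \<in> rel_interior R" using one_mem_rel_interior by blast
  then show ?thesis by (simp add: zero_prod_def)
qed

lemma R_subset_span: "R \<subseteq> span L0"
proof (rule image_subsetI)
  fix z assume "z \<in> C"
  then show "real CARD('r) *\<^sub>R z - (0, 1) \<in> span L0"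
    using C_fst[of z] C_coord_sum[of z]
    by (cases z) (simp add: span_L0 span_scale sum_subtractf sum_distrib_left[symmetric])
qed

lemma affine_hull_R: "affine hull R = span L0"
proof -
  have "0 \<in> R" using zero_mem_rel_interior_R rel_interior_subset by blast
  then have "affine hull R = span R" by (intro affine_hull_span_0 hull_inc)
  moreover have "span R = span L0"
  proof (rule ccontr)
    assume "span R \<noteq> span L0"
    moreover have "span R \<subseteq> span L0" using R_subset_span by (simp add: span_minimal)
    ultimately have "span R \<subset> span L0" by blast
    then obtain y where y: "y \<noteq> 0" "y \<in> span L0" "\<And>x. x \<in> span R \<Longrightarrow> orthogonal y x"
      using orthogonal_to_subspace_exists_gen by metis
    have sum0: "(\<Sum>i\<in>UNIV. snd y $ i) = 0" and fy: "fst y \<in> span M"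
      using y(2) by (auto simp: span_L0)
    have eq: "fst y \<bullet> x + snd y $ i = 0" if "x \<in> Ps i" for i x
    proof -
      have "y \<bullet> (real CARD('r) *\<^sub>R (x, axis i 1) - (0, 1)) = 0"
        using y(3) generator_mem[OF that] unfolding orthogonal_def by (blast intro: span_base)
      then have "real CARD('r) * (y \<bullet> (x, axis i 1)) = 0"
        using sum0 inner_one[of y] unfolding inner_diff_right inner_scaleR_right by simp
      then show ?thesis by (simp add: inner_axis_pair del: inner_Pair)
    qed
    have s: "snd y = 0" using eq[OF zero_Ps] by (simp add: vec_eq_iff)
    have "fst y = 0"
    proof (rule inner_nonneg_imp_zero[OF fy])
      fix x assume "x \<in> P"
      then obtain f where f: "x = sum f UNIV" "\<And>i. f i \<in> Ps i"
        unfolding P_sum by (metis UNIV_I sum_memE)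
      have "fst y \<bullet> f i = 0" for i using eq[OF f(2)[of i]] s by simp
      then show "0 \<le> fst y \<bullet> x" by (simp add: f(1) inner_sum_right)
    qed
    then show False using s y(1) by (simp add: prod_eq_iff)
  qed
  ultimately show ?thesis by simp
qed

lemma reflexive_R: "reflexive L0 R"
proof -
  have "\<exists>u. primitive (dual_lattice L0) u \<and> affine hull F = {x \<in> span L0. u \<bullet> x = 1}"
    if F: "F facet_of R" for F
  proof -
    let ?r = "real CARD('r)"
    let ?f = "\<lambda>z. ?r *\<^sub>R z - ((0, 1) :: 'a \<times> (real^'r))"
    define F' where "F' = {z \<in> C. ?f z \<in> F}"
    have FF': "F = ?f ` F'" using facet_of_imp_subset[OF F] unfolding F'_def by blast
    have "linear (\<lambda>x. ?r *\<^sub>R x)" "inj (\<lambda>x :: 'a \<times> (real^'r). ?r *\<^sub>R x)"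
      by (auto intro!: linearI injI simp: algebra_simps)
    then have "(?f ` F' face_of ?f ` C) = (F' face_of C)"
      unfolding affinity_image face_of_translation_eq by (rule face_of_linear_image)
    then have F'C: "F' face_of C" using F FF' unfolding facet_of_def by simp
    have "F' \<noteq> C" using F FF' facet_of_irrefl by metis
    then obtain y where y: "y \<in> D" "F' = {z \<in> C. y \<bullet> z = 0}"
      by (rule proper_face_exposed[OF F'C])
    obtain t where t: "t \<in> T" "\<And>z. z \<in> C \<Longrightarrow> y \<bullet> z = 0 \<Longrightarrow> t \<bullet> z = 0"
      using y(1) by (rule T_vanishing) blast
    have tF': "t \<bullet> z = 0" if "z \<in> F'" for z
      using t(2)[of z] that unfolding y(2) by simp
    have tD: "t \<in> D" using t(1) T_subset_D by blast
    define u :: "'a \<times> (real^'r)" where "u = (- fst t, \<chi> i. 1 / ?r - snd t $ i)"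
    have "fst t \<in> span M" "(\<Sum>i\<in>UNIV. snd t $ i) = 1"
      using tD unfolding D_mem_iff by blast+
    then have u_span: "u \<in> span L0"
      by (simp add: u_def span_L0 span_neg sum_subtractf)
    have u_inner: "u \<bullet> z = (\<Sum>i\<in>UNIV. snd z $ i) / ?r - t \<bullet> z" for z
      by (simp add: u_def inner_prod_def inner_vec_def left_diff_distrib sum_subtractf
          sum_divide_distrib)
    have u_dual: "u \<in> dual_lattice L0"
    proof -
      have "u \<bullet> x \<in> \<int>" if "x \<in> L0" for x
      proof -
        have "t \<bullet> x \<in> \<int>" using that t(1) T_subset_dlat lat_dlat_Ints mem_L0_iff by blast
        then show ?thesis using that u_inner[of x] by (simp add: mem_L0_iff)
      qed
      then show ?thesis using u_span by (simp add: dual_lattice_def)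
    qed
    have u1: "u \<bullet> x = 1" if "x \<in> F" for x
    proof -
      obtain z where z: "z \<in> F'" "x = ?f z" using \<open>x \<in> F\<close> FF' by blast
      have "u \<bullet> (0, 1) = 0"
        unfolding u_inner using tD by (simp add: D_def)
      moreover have "u \<bullet> z = 1 / ?r"
        unfolding u_inner using tF'[OF z(1)] z(1) C_coord_sum[of z] by (simp add: F'_def)
      ultimately show ?thesis using z(2) by (simp add: inner_diff_right del: inner_Pair)
    qed
    have "F \<noteq> {}" using F by (simp add: facet_of_def)
    obtain x where x: "x \<in> F" "x \<in> L0"
    proof -
      obtain W where W: "W \<subseteq> (\<Union>i. (Ps i \<inter> M) \<times> {axis i 1})" "F' = convex hull W"
        by (rule face_generators[OF F'C])
      have "W \<noteq> {}" using \<open>F \<noteq> {}\<close> FF' W(2) by auto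
      then obtain z where z: "z \<in> W" by blast
      then have "z \<in> F'" using W(2) by (simp add: hull_inc)
      then have "z \<in> C" "?f z \<in> F" unfolding F'_def by blast+
      moreover have "z \<in> lat" using z W(1) generators_lat by blast
      ultimately show ?thesis using that lat_minus_one_mem by blast
    qed
    have prim: "primitive (dual_lattice L0) u"
      unfolding primitive_def
    proof (intro conjI ballI allI impI u_dual)
      show "u \<noteq> 0" using u1[OF x(1)] by auto
      fix v and k :: nat assume v: "v \<in> dual_lattice L0" "u = real k *\<^sub>R v"
      obtain n where n: "v \<bullet> x = real_of_int n"
        using v(1) x(2) by (auto simp: dual_lattice_def elim: Ints_cases)
      have "real k * real_of_int n = 1" using u1[OF x(1)] v(2) n by simp
      then have "int k * n = 1"
        by (metis of_int_eq_1_iff of_int_mult of_int_of_nat_eq)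
      then show "k = 1" by (simp add: zmult_eq_1_iff)
    qed
    have "affine hull F = span L0 \<inter> {x. u \<bullet> x = 1}"
    proof (rule affine_dim_equal)
      show "affine hull F \<noteq> {}" using \<open>F \<noteq> {}\<close> by simp
      have aff: "affine (span L0)" by (simp add: subspace_imp_affine)
      show "affine (span L0 \<inter> {x. u \<bullet> x = 1})" by (intro affine_Int aff affine_hyperplane)
      show sub: "affine hull F \<subseteq> span L0 \<inter> {x. u \<bullet> x = 1}"
        using u1 facet_of_imp_subset[OF F] R_subset_span
        by (intro hull_minimal affine_Int aff affine_hyperplane) auto
      have "aff_dim (affine hull F) = aff_dim R - 1"
        using F by (simp add: facet_of_def)
      also have "aff_dim R = aff_dim (span L0)"
        using affine_hull_R aff_dim_affine_hull by metis
      finally have "aff_dim (affine hull F) = aff_dim (span L0) - 1" .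
      moreover have "span L0 \<inter> {x. u \<bullet> x = 1} \<noteq> {}"
        using sub \<open>F \<noteq> {}\<close> by (metis affine_hull_eq_empty subset_empty)
      moreover have "\<not> span L0 \<subseteq> {x. u \<bullet> x = 1}"
        using span_zero[of L0] by auto
      ultimately show "aff_dim (affine hull F) = aff_dim (span L0 \<inter> {x. u \<bullet> x = 1})"
        by (simp add: aff_dim_affine_Int_hyperplane[OF aff])
    qed simp
    then show ?thesis using prim by blast
  qed
  then show ?thesis
    unfolding reflexive_def
    using lattice_polytope_R affine_hull_R zero_mem_rel_interior_R by blast
qed

section \<open>The two irreducibility conditions in Cayley coordinates\<close>

definition G :: "('a \<times> (real^'r)) set \<Rightarrow> ('a \<times> (real^'r)) set" where
  "G F = {y \<in> D. \<forall>z\<in>F. y \<bullet> z = 0}"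

lemma G_face_of_D:
  assumes "F \<subseteq> C" "F \<noteq> {}"
  shows "G F face_of D"
proof -
  have "G F = \<Inter>((\<lambda>z. D \<inter> {y. z \<bullet> y = 0}) ` F)"
    using assms(2) unfolding G_def by (subst inner_commute) blast
  also have "\<dots> face_of D"
  proof (rule face_of_Inter)
    show "(\<lambda>z. D \<inter> {y. z \<bullet> y = 0}) ` F \<noteq> {}" using assms(2) by simp
    fix S assume "S \<in> (\<lambda>z. D \<inter> {y. z \<bullet> y = 0}) ` F"
    then obtain z where z: "z \<in> F" "S = D \<inter> {y. z \<bullet> y = 0}" by blast
    show "S face_of D"
      unfolding z(2)
      by (intro face_of_Int_supporting_hyperplane_ge convex_D)
         (metis D_nonneg assms(1) inner_commute subsetD z(1))
  qed
  finally show ?thesis .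
qed

lemma dual_coord_ge_1:
  assumes "F \<subseteq> C" "F \<noteq> {}" "0 < k" "y \<in> dlat"
    and "y \<in> rel_interior ((\<lambda>x. k *\<^sub>R x) ` G F)" and "\<And>z. z \<in> F \<Longrightarrow> snd z $ i = 0"
  shows "1 \<le> snd y $ i"
proof -
  have "(0, axis i 1) \<in> G F"
    using assms(6) axis_mem_D by (auto simp: G_def inner_axis_pair' simp del: inner_Pair)
  moreover have "convex (G F)" using G_face_of_D[OF assms(1,2)] face_of_imp_convex by blast
  ultimately have "0 < (0, axis i 1) \<bullet> y"
  proof (intro inner_pos_at_rel_interior_scaled[OF _ assms(3,5), where y = "(0, axis i 1)"])
    show "0 \<le> (0, axis i 1) \<bullet> y" if "y \<in> G F" for y
      using D_coord_nonneg[of y i] that by (simp add: G_def inner_axis_pair' del: inner_Pair)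
  qed (auto simp: inner_axis_pair inner_axis_axis)
  then have "0 < snd y $ i" by (simp add: inner_axis_pair' del: inner_Pair)
  then show ?thesis using assms(4) by (intro pos_Ints_ge_1) (auto simp: dlat_def)
qed

lemma scaled_dual_sum:
  assumes "y \<in> rel_interior ((\<lambda>x. k *\<^sub>R x) ` G F)"
  shows "(\<Sum>i\<in>UNIV. snd y $ i) = k"
proof -
  obtain z where "z \<in> G F" "y = k *\<^sub>R z" using assms rel_interior_subset by blast
  then show ?thesis by (auto simp: sum_distrib_left[symmetric] G_def D_mem_iff)
qed

lemma codeg_face_imp_reducible:
  assumes F: "F face_of C" "F \<noteq> {}" "F \<noteq> C"
    and eq: "codeg lat F + codeg dlat (G F) = CARD('r)"
  shows "\<exists>I. I \<noteq> {} \<and> I \<noteq> UNIV \<and> 0 \<in> rel_interior (\<Sum>i\<in>I. Ps i)"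
proof -
  have FC: "F \<subseteq> C" using F(1) by (rule face_of_imp_subset)
  have convF: "convex F" using F(1) by (rule face_of_imp_convex)
  obtain y0 where y0: "y0 \<in> D" "F = {z \<in> C. y0 \<bullet> z = 0}"
    by (rule proper_face_exposed[OF F(1,3)])
  then have y0G: "y0 \<in> G F" by (auto simp: G_def)
  have convG: "convex (G F)" using G_face_of_D[OF FC F(2)] face_of_imp_convex by blast
  define k where "k = codeg lat F"
  define l where "l = codeg dlat (G F)"
  obtain x where k: "0 < k" and x: "x \<in> lat" "x \<in> rel_interior ((\<lambda>x. real k *\<^sub>R x) ` F)"
  proof -
    obtain W where W: "finite W" "W \<subseteq> (\<Union>i. (Ps i \<inter> M) \<times> {axis i 1})" "F = convex hull W"
      by (rule face_generators[OF F(1)])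
    then have "W \<subseteq> lat" using generators_lat by blast
    then show ?thesis
      using codeg_convex_hull_attained[OF lat_zero lat_add W(1)] F(2) W(3) that k_def by metis
  qed
  obtain y where l: "0 < l" and y: "y \<in> dlat" "y \<in> rel_interior ((\<lambda>x. real l *\<^sub>R x) ` G F)"
  proof -
    have "G F face_of convex hull T" using G_face_of_D[OF FC F(2)] D_eq by simp
    then obtain W where W: "W \<subseteq> T" "G F = convex hull W"
      using face_of_convex_hull_subset[OF finite_imp_compact[OF finite_T]] by metis
    then have "finite W" "W \<subseteq> dlat" using finite_T T_subset_dlat finite_subset by blast+
    then show ?thesis
      using codeg_convex_hull_attained[OF dlat_zero dlat_add] y0G W(2) that l_def
      by (metis empty_iff)
  qed
  define I where "I = {i. \<exists>z\<in>F. snd z $ i \<noteq> 0}"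
  have xI: "1 \<le> snd x $ i" if "i \<in> I" for i
    using that coord_ge_1[OF FC convF _ x] k unfolding I_def by auto
  have xJ: "snd x $ i = 0" if "i \<notin> I" for i
  proof -
    obtain z where "z \<in> F" "x = real k *\<^sub>R z" using x(2) rel_interior_subset by blast
    then show ?thesis using that by (auto simp: I_def)
  qed
  have yJ: "1 \<le> snd y $ i" if "i \<notin> I" for i
    using that dual_coord_ge_1[OF FC F(2) _ y, of i] l unfolding I_def by auto
  have y_nonneg: "0 \<le> snd y $ i" for i
  proof -
    obtain z where "z \<in> G F" "y = real l *\<^sub>R z" using y(2) rel_interior_subset by blast
    then show ?thesis using D_coord_nonneg[of z i] by (auto simp: G_def)
  qed
  have "(\<Sum>i\<in>UNIV. snd x $ i + snd y $ i - 1) = 0"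
    using scaled_coord_sum[OF FC x(2)] scaled_dual_sum[OF y(2)] eq
    by (simp add: sum.distrib sum_subtractf k_def l_def flip: of_nat_add)
  moreover have "0 \<le> snd x $ i + snd y $ i - 1" for i
    using xI[of i] xJ[of i] yJ[of i] y_nonneg[of i] by (cases "i \<in> I") auto
  ultimately have tot: "snd x $ i + snd y $ i = 1" for i
    by (subst (asm) sum_nonneg_eq_0_iff) (auto simp: algebra_simps)
  have x_ind: "snd x $ i = of_bool (i \<in> I)" and y_ind: "snd y $ i = of_bool (i \<notin> I)" for i
    using tot[of i] xI[of i] xJ[of i] yJ[of i] y_nonneg[of i] by (cases "i \<in> I"; force)+
  have pos: "0 < y \<bullet> z" if z: "z \<in> C" "z \<notin> F" for z
  proof -
    have "0 < z \<bullet> y"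
    proof (rule inner_pos_at_rel_interior_scaled[OF convG _ y(2) _ y0G])
      show "0 \<le> z \<bullet> y" if "y \<in> G F" for y
        using D_nonneg[of y z] that z(1) by (simp add: G_def inner_commute)
      show "z \<bullet> y0 \<noteq> 0" using y0(2) z by (auto simp: inner_commute)
    qed (use l in simp)
    then show ?thesis by (simp add: inner_commute)
  qed
  have zero: "y \<bullet> z = 0" if "z \<in> F" for z
  proof -
    obtain z' where "z' \<in> G F" "y = real l *\<^sub>R z'" using y(2) rel_interior_subset by blast
    then show ?thesis using that by (auto simp: G_def)
  qed
  have nonneg: "0 \<le> fst y \<bullet> q" if q: "q \<in> Ps i" for q i
  proof -
    obtain q' where q': "q' \<in> Ps i" "q' \<in> M" "\<And>x. x \<in> Ps i \<Longrightarrow> (- fst y) \<bullet> x \<le> (- fst y) \<bullet> q'"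
      using max_Ps[of i "- fst y"] by metis
    let ?z = "(q', axis i 1) :: 'a \<times> (real^'r)"
    have zC: "?z \<in> C" using q'(1) by (rule generator_mem)
    have yz: "y \<bullet> ?z = fst y \<bullet> q' + snd y $ i" by (simp add: inner_axis_pair)
    have "0 \<le> fst y \<bullet> q'"
    proof (cases "i \<in> I")
      case True
      have "0 \<le> y \<bullet> ?z" using pos[OF zC] zero by fastforce
      then show ?thesis using yz True by (simp add: y_ind)
    next
      case False
      then have "?z \<notin> F" unfolding I_def by force
      then have "0 < y \<bullet> ?z" using pos zC by blast
      moreover have "?z \<in> lat" using q' generators_lat by blast
      ultimately have "1 \<le> y \<bullet> ?z" using lat_dlat_Ints y(1) pos_Ints_ge_1 by blast
      then show ?thesis using yz False by (simp add: y_ind)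
    qed
    then show ?thesis using q'(3)[OF q] by simp
  qed
  have fy: "fst y = 0"
  proof (rule inner_nonneg_imp_zero)
    show "fst y \<in> span M" using y(1) by (auto simp: dlat_def dual_lattice_def)
    show "0 \<le> fst y \<bullet> x" if "x \<in> P" for x
      using that unfolding P_sum
      by (rule sum_memE) (use nonneg in \<open>auto simp: inner_sum_right intro!: sum_nonneg\<close>)
  qed
  have gen: "(q, axis i 1) \<in> F" if "i \<in> I" "q \<in> Ps i" for q i
  proof (rule ccontr)
    assume "(q, axis i 1) \<notin> F"
    then have "0 < y \<bullet> (q, axis i 1)" using pos generator_mem[OF that(2)] by blast
    then show False using that(1) fy by (simp add: inner_axis_pair y_ind del: inner_Pair)
  qed
  have gen': "i \<in> I" if "(q, axis i 1) \<in> F" for q i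
    using that unfolding I_def by force
  have fx: "fst x = 0"
    by (rule fst_zero_of_interior_lattice_point[OF FC convF _ x])
       (use k gen zero_Ps in \<open>auto simp: x_ind\<close>)
  have "0 \<in> rel_interior (\<Sum>i\<in>I. Ps i)"
  proof (rule rel_interiorI_inner[OF convex_sum_Ps])
    show "0 \<in> (\<Sum>i\<in>I. Ps i)" using sum_memI[of I "\<lambda>_. 0"] zero_Ps by simp
    fix a q assume a: "\<And>q. q \<in> (\<Sum>i\<in>I. Ps i) \<Longrightarrow> a \<bullet> 0 \<le> a \<bullet> q" and q: "q \<in> (\<Sum>i\<in>I. Ps i)"
    have vanish: "a \<bullet> q = 0" if "i \<in> I" "q \<in> Ps i" for i q
    proof (rule ccontr)
      assume "a \<bullet> q \<noteq> 0"
      have "0 < (a, 0) \<bullet> x"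
      proof (rule inner_pos_at_rel_interior_scaled[OF convF _ x(2) _ gen[OF that]])
        show "0 \<le> (a, 0) \<bullet> z" if "z \<in> F" for z
          by (rule inner_ge_on_face[OF F(1) _ that])
             (use a Ps_subset_sum gen' in \<open>force simp: inner_axis_pair\<close>)
      qed (use k \<open>a \<bullet> q \<noteq> 0\<close> in auto)
      then show False using fx by (cases x) simp
    qed
    show "a \<bullet> q = a \<bullet> 0"
      using q by (rule sum_memE) (use vanish in \<open>simp add: inner_sum_right\<close>)
  qed
  moreover have "I \<noteq> {}"
  proof -
    obtain z where "z \<in> F" using F(2) by blast
    then have "(\<Sum>i\<in>UNIV. snd z $ i) \<noteq> 0" using C_coord_sum[of z] FC by auto
    then show ?thesis using \<open>z \<in> F\<close> unfolding I_def by (force dest: sum.not_neutral_contains_not_neutral)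
  qed
  moreover have "I \<noteq> UNIV"
  proof
    assume "I = UNIV"
    then have "y \<bullet> z = 0" for z using fy y_ind by (simp add: inner_prod_def inner_vec_def)
    then show False using pos F(3) FC by force
  qed
  ultimately show ?thesis by blast
qed

lemma reducible_imp_face:
  assumes I: "I \<noteq> {}" "I \<noteq> UNIV" and zero: "0 \<in> rel_interior (\<Sum>i\<in>I. Ps i)"
  defines "F \<equiv> coord_face I"
  shows "F face_of C" "F \<noteq> {}" "F \<noteq> C" "codeg lat F + codeg dlat (G F) = CARD('r)"
proof -
  show F: "F face_of C" unfolding F_def by (rule coord_face_of_C)
  have FC: "F \<subseteq> C" using F by (rule face_of_imp_subset)
  have convF: "convex F" using F by (rule face_of_imp_convex)
  have gen: "(x, axis i 1) \<in> F \<longleftrightarrow> i \<in> I" if "x \<in> Ps i" for x i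
    using generator_mem_coord_face_iff[OF that] by (simp add: F_def)
  show ne: "F \<noteq> {}" using I(1) gen[OF zero_Ps] by blast
  show "F \<noteq> C" using I(2) gen[OF zero_Ps] generator_mem[OF zero_Ps] by blast
  have codegF: "codeg lat F = card I"
  proof (rule antisym)
    have n: "0 < card I" using I(1) by (simp add: card_gt_0_iff)
    have ri: "ind I \<in> rel_interior ((\<lambda>x. real (card I) *\<^sub>R x) ` F)"
      unfolding F_def by (rule ind_mem_rel_interior[OF I(1) zero])
    note att = codeg_attained[OF ne n ind_lat ri]
    show "codeg lat F \<le> card I" by (rule att(2))
    obtain x where x: "x \<in> lat" "x \<in> rel_interior ((\<lambda>x. real (codeg lat F) *\<^sub>R x) ` F)"
      using att(3) by blast
    have c: "0 < real (codeg lat F)" using att(1) by simp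
    have "real (card I) = (\<Sum>i\<in>UNIV. of_bool (i \<in> I))" by simp
    also have "\<dots> \<le> (\<Sum>i\<in>UNIV. snd x $ i)"
    proof (rule sum_mono)
      fix i
      obtain z where "z \<in> F" "x = real (codeg lat F) *\<^sub>R z" using x(2) rel_interior_subset by blast
      then have "0 \<le> snd x $ i" using C_coord_nonneg[of z i] FC by auto
      moreover have "1 \<le> snd x $ i" if "i \<in> I"
        using coord_ge_1[OF FC convF c x, of "(0, axis i 1)" i] gen[OF zero_Ps] that by simp
      ultimately show "of_bool (i \<in> I) \<le> snd x $ i" by auto
    qed
    also have "\<dots> = real (codeg lat F)" by (rule scaled_coord_sum[OF FC x(2)])
    finally show "card I \<le> codeg lat F" by simp
  qed
  let ?J = "- I"
  have J: "?J \<noteq> {}" using I(2) by auto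
  then have n: "0 < card ?J" by (simp add: card_gt_0_iff)
  have convG: "convex (G F)" using G_face_of_D[OF FC ne] face_of_imp_convex by blast
  have vanJ: "snd z $ j = 0" if "z \<in> F" "j \<in> ?J" for z j
    using that unfolding F_def coord_face_def by auto
  have axG: "(0, axis j 1) \<in> G F" if "j \<in> ?J" for j
    using vanJ[OF _ that] axis_mem_D by (auto simp: G_def inner_axis_pair' simp del: inner_Pair)
  let ?c = "(1 / real (card ?J)) *\<^sub>R ind ?J"
  have cG: "?c \<in> G F" by (rule ind_mem_scaled[OF J convG axG])
  then have Gne: "G F \<noteq> {}" by blast
  have "?c \<in> rel_interior (G F)"
    unfolding convex_rel_interior_iff[OF convG Gne]
  proof
    fix y assume y: "y \<in> G F"
    obtain K where K: "0 < K" "\<And>z. z \<in> C \<Longrightarrow> norm z \<le> K"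
      using polytope_imp_bounded[OF polytope_C] unfolding bounded_pos by auto
    define B where "B = norm y * K + 1"
    have B: "0 < B" using K(1) by (simp add: B_def add_nonneg_pos)
    have yB: "y \<bullet> z \<le> B" if "z \<in> C" for z
      using norm_cauchy_schwarz[of y z] mult_left_mono[OF K(2)[OF that] norm_ge_zero[of y]]
      unfolding B_def by linarith
    define e where "e = 1 + 1 / (real (card ?J) * B)"
    let ?y = "(1 - e) *\<^sub>R y + e *\<^sub>R ?c"
    have e: "1 < e" using n B by (simp add: e_def)
    have yD: "y \<in> D" and cD: "?c \<in> D" using y cG by (auto simp only: G_def mem_Collect_eq)
    have "0 \<le> ?y \<bullet> z" if "z \<in> C" for z
    proof (rule inner_ge_on_C[OF _ that])
      fix i x assume x: "x \<in> Ps i"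
      let ?z = "(x, axis i 1) :: 'a \<times> (real^'r)"
      have cz: "?c \<bullet> ?z = of_bool (i \<in> ?J) / real (card ?J)"
        by (simp add: inner_ind inner_axis_pair ind_def)
      have yz: "?y \<bullet> ?z = e * (?c \<bullet> ?z) - (e - 1) * (y \<bullet> ?z)"
        by (simp add: inner_add_left algebra_simps del: inner_Pair)
      show "0 \<le> ?y \<bullet> ?z"
      proof (cases "i \<in> I")
        case True
        then have "?z \<in> F" using gen[OF x] by simp
        then have "y \<bullet> ?z = 0" using y unfolding G_def by blast
        then show ?thesis unfolding yz cz using True by simp
      next
        case False
        have "(e - 1) * (y \<bullet> ?z) \<le> (e - 1) * B"
          using yB[OF generator_mem[OF x]] e by (intro mult_left_mono) auto
        also have "\<dots> = 1 / real (card ?J)" using B by (simp add: e_def)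
        also have "\<dots> \<le> e / real (card ?J)" using e n by (simp add: divide_right_mono)
        finally show ?thesis unfolding yz cz using False by simp
      qed
    qed
    moreover have "fst ?y \<in> span M"
      using yD unfolding D_def by (simp add: ind_def span_scale)
    moreover have "?y \<bullet> (0, 1) = 1"
    proof -
      have "y \<bullet> (0, 1) = 1" "?c \<bullet> (0, 1) = 1" using yD cD unfolding D_def by blast+
      then show ?thesis by (simp only: inner_add_left[of "_ *\<^sub>R _"] inner_scaleR_left[of _ y]
        inner_scaleR_left[of e]) simp
    qed
    moreover have "\<forall>z\<in>F. ?y \<bullet> z = 0"
      using y cG unfolding G_def inner_add_left inner_scaleR_left by simp
    ultimately have "?y \<in> G F" by (simp add: G_def D_def)
    then show "\<exists>e>1. (1 - e) *\<^sub>R y + e *\<^sub>R ?c \<in> G F" using e by blast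
  qed
  then have ri: "ind ?J \<in> rel_interior ((\<lambda>x. real (card ?J) *\<^sub>R x) ` G F)"
    using n by (subst mem_rel_interior_scaled_iff) auto
  have codegG: "codeg dlat (G F) = card ?J"
  proof (rule antisym)
    note att = codeg_attained[OF Gne n ind_dlat ri]
    show "codeg dlat (G F) \<le> card ?J" by (rule att(2))
    obtain y where y: "y \<in> dlat" "y \<in> rel_interior ((\<lambda>x. real (codeg dlat (G F)) *\<^sub>R x) ` G F)"
      using att(3) by blast
    have c: "0 < real (codeg dlat (G F))" using att(1) by simp
    have "real (card ?J) = (\<Sum>i\<in>UNIV. of_bool (i \<in> ?J))" by (simp add: Compl_eq)
    also have "\<dots> \<le> (\<Sum>i\<in>UNIV. snd y $ i)"
    proof (rule sum_mono)
      fix i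
      obtain z where "z \<in> G F" "y = real (codeg dlat (G F)) *\<^sub>R z"
        using y(2) rel_interior_subset by blast
      then have "0 \<le> snd y $ i" using D_coord_nonneg[of z i] by (auto simp: G_def)
      moreover have "1 \<le> snd y $ i" if "i \<in> ?J"
        using dual_coord_ge_1[OF FC ne c y] vanJ that by blast
      ultimately show "of_bool (i \<in> ?J) \<le> snd y $ i" by auto
    qed
    also have "\<dots> = real (codeg dlat (G F))" by (rule scaled_dual_sum[OF y(2)])
    finally show "card ?J \<le> codeg dlat (G F)" by simp
  qed
  show "codeg lat F + codeg dlat (G F) = CARD('r)"
    using codegF codegG card_Un_disjoint[of I ?J] by (simp add: Compl_partition)
qed

end

section \<open>Cayley coordinates versus the cone over the translated polytope\<close>

context nef
begin

context
  fixes p :: "'a \<times> (real^'r)"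
  assumes p: "p \<in> cayley_lattice M"
begin

lemma p_lat: "p \<in> lat" and p_sum: "(\<Sum>i\<in>UNIV. snd p $ i) = 1"
  using p by (auto simp: cayley_lattice_def lat_def)

lemma lat_diff: "x \<in> lat \<Longrightarrow> y \<in> lat \<Longrightarrow> x - y \<in> lat"
  using is_lattice_diff[OF lattice] by (auto simp: lat_def)

lemma translate_cayley_lattice: "(\<lambda>x. x - p) ` cayley_lattice M = L0"
proof -
  have "z - p \<in> L0 \<longleftrightarrow> z \<in> cayley_lattice M" for z
  proof -
    have "z - p \<in> lat \<longleftrightarrow> z \<in> lat"
      using lat_diff[of z p] lat_add[of "z - p" p] p_lat by auto
    then show ?thesis
      unfolding mem_L0_iff using p_sum
      by (auto simp: cayley_lattice_def lat_def sum_subtractf)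
  qed
  then show ?thesis using image_iff[of _ "\<lambda>x. x - p" "cayley_lattice M"]
    by (metis (no_types, lifting) add_diff_cancel set_eqI)
qed

abbreviation Q :: "('a \<times> (real^'r)) set" where "Q \<equiv> (\<lambda>x. x - p) ` C"

definition m :: "'a \<times> (real^'r)" where "m = (0, 1) - real CARD('r) *\<^sub>R p"

lemma scaled_p_lat: "real k *\<^sub>R p \<in> lat"
  using scaleR_nat_mem[of lat p k] lat_zero lat_add p_lat by blast

lemma m_lat: "m \<in> L0"
proof -
  have "(0, 1) \<in> lat" using ind_lat[of UNIV] by (simp add: ind_UNIV)
  then show ?thesis
    unfolding mem_L0_iff m_def using lat_diff scaled_p_lat p_sum
    by (simp add: sum_subtractf sum_distrib_left[symmetric])
qed

lemma scaled_translate: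
  "(\<lambda>x. real k *\<^sub>R x) ` (\<lambda>x. x - p) ` F = (+) (- (real k *\<^sub>R p)) ` ((\<lambda>x. real k *\<^sub>R x) ` F)"
  by (simp add: image_image scaleR_diff_right)

lemma mem_L0_rel_interior_iff:
  assumes "F \<subseteq> C"
  shows "x \<in> L0 \<inter> rel_interior ((\<lambda>x. real k *\<^sub>R x) ` (\<lambda>x. x - p) ` F) \<longleftrightarrow>
    x + real k *\<^sub>R p \<in> lat \<inter> rel_interior ((\<lambda>x. real k *\<^sub>R x) ` F)"
proof -
  let ?S = "rel_interior ((\<lambda>x. real k *\<^sub>R x) ` F)"
  have "x \<in> rel_interior ((\<lambda>x. real k *\<^sub>R x) ` (\<lambda>x. x - p) ` F) \<longleftrightarrow> x + real k *\<^sub>R p \<in> ?S"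
    unfolding scaled_translate rel_interior_translation
    by (auto simp: image_iff algebra_simps intro: bexI[where x = "x + real k *\<^sub>R p"])
  moreover have "x \<in> L0 \<longleftrightarrow> x + real k *\<^sub>R p \<in> lat" if "x + real k *\<^sub>R p \<in> ?S"
  proof -
    have "(\<Sum>i\<in>UNIV. snd x $ i) = 0"
      using scaled_coord_sum[OF assms that] p_sum
      by (simp add: sum.distrib sum_distrib_left[symmetric])
    then show ?thesis
      unfolding mem_L0_iff
      using lat_add[OF _ scaled_p_lat, of x k] lat_diff[OF _ scaled_p_lat, of "x + real k *\<^sub>R p" k]
      by auto
  qed
  ultimately show ?thesis by blast
qed

lemma codeg_translate:
  assumes "F \<subseteq> C"
  shows "codeg L0 ((\<lambda>x. x - p) ` F) = codeg lat F"
proof -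
  have "L0 \<inter> rel_interior ((\<lambda>x. real k *\<^sub>R x) ` (\<lambda>x. x - p) ` F) = {} \<longleftrightarrow>
        lat \<inter> rel_interior ((\<lambda>x. real k *\<^sub>R x) ` F) = {}" for k
    using mem_L0_rel_interior_iff[OF assms, of _ k]
    by (metis (no_types, lifting) diff_add_cancel equals0D equals0I)
  then show ?thesis by (simp add: codeg_def)
qed

lemma gorenstein_Q: "gorenstein L0 CARD('r) m Q"
  unfolding gorenstein_def
proof (intro conjI)
  let ?r = "real CARD('r)"
  show "0 < CARD('r)" by simp
  have RQ: "(\<lambda>x. ?r *\<^sub>R x - m) ` Q = R"
    by (simp add: image_image m_def scaleR_diff_right)
  then show "reflexive L0 ((\<lambda>x. ?r *\<^sub>R x - m) ` Q)" using reflexive_R by simp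
  obtain W where W: "finite W" "W \<subseteq> (\<Union>i. (Ps i \<inter> M) \<times> {axis i 1})" "C = convex hull W"
    by (rule C_generators)
  have "(\<lambda>x. x - p) ` W \<subseteq> L0"
  proof (rule image_subsetI)
    fix w assume w: "w \<in> W"
    then have "w \<in> C" using W(3) by (simp add: hull_inc)
    moreover have "w - p \<in> lat" using w W(2) generators_lat lat_diff p_lat by blast
    ultimately show "w - p \<in> L0"
      using C_coord_sum[of w] p_sum by (simp add: mem_L0_iff sum_subtractf)
  qed
  moreover have "Q = convex hull ((\<lambda>x. x - p) ` W)"
    using convex_hull_translation[of "- p" W] W(3) by simp
  ultimately show "lattice_polytope L0 Q"
    unfolding lattice_polytope_def using W(1) by blast
  show "affine hull Q = span L0"
  proof -
    have "Q = (\<lambda>x. (1 / ?r) *\<^sub>R x) ` ((+) m ` R)"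
      by (simp add: image_image m_def scaleR_diff_right)
    then have "affine hull Q = (\<lambda>x. (1 / ?r) *\<^sub>R x) ` ((+) m ` (affine hull R))"
      using affine_hull_linear_image[of "\<lambda>x. (1 / ?r) *\<^sub>R x" "(+) m ` R"]
        affine_hull_translation[of m R] by (simp add: bounded_linear_scaleR_right)
    also have "\<dots> = span L0"
      unfolding affine_hull_R
    proof
      have ms: "m \<in> span L0" using m_lat by (rule span_base)
      then show "(\<lambda>x. (1 / ?r) *\<^sub>R x) ` ((+) m ` span L0) \<subseteq> span L0"
        by (auto intro!: span_scale span_add simp del: scaleR_eq_0_iff)
      show "span L0 \<subseteq> (\<lambda>x. (1 / ?r) *\<^sub>R x) ` ((+) m ` span L0)"
      proof
        fix x assume "x \<in> span L0"
        then have "?r *\<^sub>R x - m \<in> span L0" using ms by (intro span_diff span_scale)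
        moreover have "x = (1 / ?r) *\<^sub>R (m + (?r *\<^sub>R x - m))" by simp
        ultimately show "x \<in> (\<lambda>x. (1 / ?r) *\<^sub>R x) ` ((+) m ` span L0)" by blast
      qed
    qed
    finally show ?thesis .
  qed
  show "L0 \<inter> rel_interior ((\<lambda>x. ?r *\<^sub>R x) ` Q) = {m}"
  proof -
    have "x \<in> L0 \<inter> rel_interior ((\<lambda>x. ?r *\<^sub>R x) ` Q) \<longleftrightarrow> x = m" for x
    proof -
      have "x \<in> L0 \<inter> rel_interior ((\<lambda>x. ?r *\<^sub>R x) ` Q) \<longleftrightarrow> x + ?r *\<^sub>R p = (0, 1)"
        unfolding mem_L0_rel_interior_iff[OF subset_refl]
        using interior_lattice_point_unique[of "x + ?r *\<^sub>R p"] one_mem_rel_interior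
          ind_lat[of UNIV, unfolded ind_UNIV]
        by (metis IntD1 IntD2 IntI)
      then show ?thesis unfolding m_def eq_diff_eq .
    qed
    then show ?thesis by blast
  qed
qed

text \<open>\<open>Psi\<close> is the transpose of the isomorphism \<open>(z, k) \<mapsto> z + k p\<close> between the cone lattice of
  \<open>C - p\<close> and \<open>lat\<close>; subtracting the mean puts the result into the span of \<open>L0 \<times> \<int>\<close>.\<close>

definition Psi :: "'a \<times> (real^'r) \<Rightarrow> ('a \<times> (real^'r)) \<times> real" where
  "Psi y = (y - ((y \<bullet> (0, 1)) / real CARD('r)) *\<^sub>R (0, 1), y \<bullet> p)"

lemma inner_one_p: "(0, 1) \<bullet> p = 1"
  using p_sum inner_one[of p] by (simp add: inner_commute)

lemma linear_Psi: "linear Psi"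
proof (rule linearI)
  show "Psi (x + y) = Psi x + Psi y" for x y
    by (simp add: Psi_def inner_add_left add_divide_distrib scaleR_add_left
        del: inner_Pair scaleR_Pair)
  show "Psi (c *\<^sub>R x) = c *\<^sub>R Psi x" for c x
    by (simp add: Psi_def scaleR_Pair[of c "_ - _"] scaleR_diff_right del: inner_Pair scaleR_Pair)
qed

lemma inj_Psi: "inj Psi"
  unfolding linear_injective_0[OF linear_Psi]
proof (intro allI impI)
  fix y assume "Psi y = 0"
  then have y: "y = ((y \<bullet> (0, 1)) / real CARD('r)) *\<^sub>R (0, 1)" and "y \<bullet> p = 0"
    by (simp_all add: Psi_def zero_prod_def[where ?'b = real] del: inner_Pair scaleR_Pair)
  then have "(y \<bullet> (0, 1)) / real CARD('r) = 0"
    using inner_one_p by (metis inner_scaleR_left mult.right_neutral)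
  then show "y = 0" using y by (metis scaleR_zero_left)
qed

lemma inner_Psi:
  assumes "(\<Sum>i\<in>UNIV. snd z $ i) = 0"
  shows "Psi y \<bullet> (z, k) = y \<bullet> (z + k *\<^sub>R p)"
proof -
  have "(0, 1) \<bullet> z = 0" using assms inner_one[of z] by (simp add: inner_commute)
  then show ?thesis
    unfolding Psi_def inner_Pair inner_diff_left inner_scaleR_left inner_add_right
    by (simp add: mult.commute)
qed

lemma inner_Psi_translate: "z \<in> C \<Longrightarrow> Psi y \<bullet> (z - p, 1) = y \<bullet> z"
  using C_coord_sum[of z] p_sum by (subst inner_Psi) (auto simp: sum_subtractf)

lemma span_L0_Ints: "span (L0 \<times> \<int>) = span L0 \<times> (UNIV :: real set)"
proof
  show "span (L0 \<times> \<int>) \<subseteq> span L0 \<times> (UNIV :: real set)"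
    by (intro span_minimal subspace_Times subspace_span subspace_UNIV) (auto simp: span_base)
  show "span L0 \<times> (UNIV :: real set) \<subseteq> span (L0 \<times> \<int>)"
  proof
    fix x :: "('a \<times> (real^'r)) \<times> real" assume x: "x \<in> span L0 \<times> UNIV"
    have "(fst x, 0) \<in> span (L0 \<times> {0::real})" using x by (auto simp: span_Times_sing2)
    also have "\<dots> \<subseteq> span (L0 \<times> \<int>)" by (intro span_mono) auto
    finally have *: "(fst x, 0::real) \<in> span (L0 \<times> \<int>)" .
    have "(0, 1::real) \<in> span (L0 \<times> \<int>)" using L0_zero by (intro span_base) auto
    from span_add[OF * span_scale[OF this, of "snd x"]]
    show "x \<in> span (L0 \<times> \<int>)" by simp
  qed
qed

lemma Psi_mem_span_iff: "Psi y \<in> span (L0 \<times> \<int>) \<longleftrightarrow> fst y \<in> span M"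
  unfolding span_L0_Ints span_L0 Psi_def
  by (cases y) (auto simp: sum_subtractf inner_one simp del: inner_Pair)

lemma span_subset_range_Psi:
  assumes "y \<in> span (L0 \<times> \<int>)"
  shows "y \<in> range Psi"
proof -
  obtain z k where zk: "y = (z, k)" by (cases y)
  have z: "(\<Sum>i\<in>UNIV. snd z $ i) = 0"
    using assms unfolding zk span_L0_Ints span_L0 by auto
  let ?y = "z + (k - z \<bullet> p) *\<^sub>R (0, 1)"
  have "z \<bullet> (0, 1) = 0" using z inner_one by metis
  moreover have "(0, 1) \<bullet> (0, 1 :: real^'r) = real CARD('r)" by (simp add: inner_vec_def)
  ultimately have "?y \<bullet> (0, 1) = (k - z \<bullet> p) * real CARD('r)"
    by (simp only: inner_add_left inner_scaleR_left) simp
  moreover have "?y \<bullet> p = k"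
    using inner_one_p by (simp only: inner_add_left inner_scaleR_left) simp
  ultimately have "Psi ?y = y" unfolding Psi_def zk by simp
  then show ?thesis by (metis rangeI)
qed

lemma dual_lattice_eq: "dual_lattice (L0 \<times> \<int>) = Psi ` dlat"
proof
  show "Psi ` dlat \<subseteq> dual_lattice (L0 \<times> \<int>)"
  proof (rule image_subsetI)
    fix y assume y: "y \<in> dlat"
    have "Psi y \<bullet> x \<in> \<int>" if x: "x \<in> L0 \<times> \<int>" for x
    proof -
      obtain z k where zk: "x = (z, real_of_int k)" "z \<in> L0"
        using x by (auto elim!: Ints_cases)
      have "y \<bullet> z + real_of_int k * (y \<bullet> p) \<in> \<int>"
        using y zk(2) p_lat lat_dlat_Ints by (intro Ints_add Ints_mult) (auto simp: mem_L0_iff)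
      then show ?thesis
        using inner_Psi[of z y "real_of_int k"] zk by (simp add: mem_L0_iff inner_add_right)
    qed
    moreover have "Psi y \<in> span (L0 \<times> \<int>)"
      unfolding Psi_mem_span_iff using y by (auto simp: dlat_def dual_lattice_def)
    ultimately show "Psi y \<in> dual_lattice (L0 \<times> \<int>)" unfolding dual_lattice_def by blast
  qed
  show "dual_lattice (L0 \<times> \<int>) \<subseteq> Psi ` dlat"
  proof
    fix x :: "('a \<times> (real^'r)) \<times> real" assume x: "x \<in> dual_lattice (L0 \<times> \<int>)"
    then obtain y where y: "x = Psi y" using span_subset_range_Psi unfolding dual_lattice_def by blast
    have int: "y \<bullet> (z + real_of_int k *\<^sub>R p) \<in> \<int>" if "z \<in> L0" for z k
    proof -
      have "Psi y \<bullet> (z, real_of_int k) \<in> \<int>"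
        using x that unfolding y dual_lattice_def by auto
      then show ?thesis using inner_Psi[of z y "real_of_int k"] that by (simp add: mem_L0_iff)
    qed
    have "fst y \<bullet> q \<in> \<int>" if "q \<in> M" for q
    proof -
      have "(q, 0) \<in> L0" using that by (simp add: L0_def)
      then show ?thesis using int[of "(q, 0)" 0] by (cases y) simp
    qed
    moreover have "fst y \<in> span M"
      using x Psi_mem_span_iff unfolding y dual_lattice_def by blast
    moreover have "snd y $ i \<in> \<int>" for i
    proof -
      have "(0, axis i 1) \<in> cayley_lattice M"
        using is_lattice_zero[OF lattice] by (auto simp: cayley_lattice_def axis_def)
      then have "(0, axis i 1) - p \<in> L0" using translate_cayley_lattice by blast
      then have "y \<bullet> (0, axis i 1) \<in> \<int>" using int[of _ 1] by fastforce
      then show ?thesis by (simp add: inner_axis_pair del: inner_Pair)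
    qed
    ultimately have "y \<in> dlat" by (cases y) (auto simp: dlat_def dual_lattice_def)
    then show "x \<in> Psi ` dlat" using y by blast
  qed
qed

lemma dual_gorenstein_eq: "dual_gorenstein L0 CARD('r) m Q = Psi ` D"
proof -
  have "Psi y \<in> dual_gorenstein L0 CARD('r) m Q \<longleftrightarrow> y \<in> D" for y
  proof -
    have "(\<forall>z\<in>polytope_cone Q. 0 \<le> Psi y \<bullet> z) \<longleftrightarrow> (\<forall>z\<in>C. 0 \<le> y \<bullet> z)"
    proof
      assume *: "\<forall>z\<in>polytope_cone Q. 0 \<le> Psi y \<bullet> z"
      show "\<forall>z\<in>C. 0 \<le> y \<bullet> z"
      proof
        fix z assume z: "z \<in> C"
        then have "(z - p, 1) \<in> polytope_cone Q"
          unfolding polytope_cone_def by (intro hull_inc) auto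
        then show "0 \<le> y \<bullet> z" using * inner_Psi_translate[OF z] by metis
      qed
    next
      assume *: "\<forall>z\<in>C. 0 \<le> y \<bullet> z"
      show "\<forall>z\<in>polytope_cone Q. 0 \<le> Psi y \<bullet> z"
      proof
        fix x assume "x \<in> polytope_cone Q"
        then obtain c z where cz: "0 \<le> c" "z \<in> C" "x = c *\<^sub>R (z - p, 1)"
          unfolding polytope_cone_def cone_hull_expl by blast
        have "Psi y \<bullet> x = c * (y \<bullet> z)"
          unfolding cz(3) inner_scaleR_right inner_Psi_translate[OF cz(2)] ..
        then show "0 \<le> Psi y \<bullet> x" using * cz by simp
      qed
    qed
    moreover have "Psi y \<bullet> (m, real CARD('r)) = y \<bullet> (0, 1)"
      using m_lat by (subst inner_Psi) (auto simp: mem_L0_iff m_def)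
    ultimately show ?thesis
      unfolding dual_gorenstein_def dual_cone_def D_def mem_Collect_eq Psi_mem_span_iff
      by (simp only: conj_assoc)
  qed
  moreover have "dual_gorenstein L0 CARD('r) m Q \<subseteq> range Psi"
    using span_subset_range_Psi unfolding dual_gorenstein_def dual_cone_def by blast
  ultimately show ?thesis by blast
qed

lemma dual_face_eq:
  assumes "F \<subseteq> C"
  shows "dual_face L0 CARD('r) m Q ((\<lambda>x. x - p) ` F) = Psi ` G F"
proof -
  have "Psi y \<bullet> (z - p, 1) = y \<bullet> z" if "z \<in> F" for y z
    using inner_Psi_translate assms that by blast
  then show ?thesis
    unfolding dual_face_def dual_gorenstein_eq G_def by force
qed

lemma codeg_sum_eq:
  assumes "F \<subseteq> C"
  shows "codeg L0 ((\<lambda>x. x - p) ` F) +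
      codeg (dual_lattice (L0 \<times> \<int>)) (dual_face L0 CARD('r) m Q ((\<lambda>x. x - p) ` F)) =
    codeg lat F + codeg dlat (G F)"
  unfolding codeg_translate[OF assms] dual_face_eq[OF assms] dual_lattice_eq
    codeg_linear_image[OF linear_Psi inj_Psi] ..

lemma translate_face_iff: "(\<lambda>x. x - p) ` F face_of Q \<longleftrightarrow> F face_of C"
  using face_of_translation_eq[of "- p" F C] by simp

lemma irreducible_iff:
  "irreducible_nef_partition Ps \<longleftrightarrow> irreducible_gorenstein_at p (cayley_lattice M) C"
proof
  assume irr: "irreducible_nef_partition Ps"
  have "\<not> (\<exists>F. F face_of Q \<and> F \<noteq> {} \<and> F \<noteq> Q \<and>
      codeg L0 F + codeg (dual_lattice (L0 \<times> \<int>)) (dual_face L0 CARD('r) m Q F) = CARD('r))"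
  proof clarify
    fix F
    assume F: "F face_of Q" "F \<noteq> {}" "F \<noteq> Q"
      and eq: "codeg L0 F + codeg (dual_lattice (L0 \<times> \<int>)) (dual_face L0 CARD('r) m Q F) = CARD('r)"
    define F' where "F' = (\<lambda>x. x + p) ` F"
    have FF': "F = (\<lambda>x. x - p) ` F'" by (simp add: F'_def image_image)
    have F'C: "F' face_of C" using F(1) unfolding FF' translate_face_iff .
    have "codeg lat F' + codeg dlat (G F') = CARD('r)"
      using eq unfolding FF' codeg_sum_eq[OF face_of_imp_subset[OF F'C]] .
    moreover have "F' \<noteq> {}" "F' \<noteq> C" using F(2,3) FF' by auto
    ultimately show False
      using codeg_face_imp_reducible[OF F'C] irr unfolding irreducible_nef_partition_def by blast
  qed
  then show "irreducible_gorenstein_at p (cayley_lattice M) C"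
    unfolding irreducible_gorenstein_at_def translate_cayley_lattice irreducible_gorenstein_def
    using gorenstein_Q C_nonempty by blast
next
  assume "irreducible_gorenstein_at p (cayley_lattice M) C"
  then obtain r' m' where g: "gorenstein L0 r' m' Q"
    and no: "\<not> (\<exists>F. F face_of Q \<and> F \<noteq> {} \<and> F \<noteq> Q \<and>
      codeg L0 F + codeg (dual_lattice (L0 \<times> \<int>)) (dual_face L0 r' m' Q F) = r')"
    unfolding irreducible_gorenstein_at_def translate_cayley_lattice irreducible_gorenstein_def by blast
  show "irreducible_nef_partition Ps"
    unfolding irreducible_nef_partition_def
  proof clarify
    fix I :: "'r set"
    assume I: "I \<noteq> {}" "I \<noteq> UNIV" and z: "0 \<in> rel_interior (\<Sum>i\<in>I. Ps i)"
    obtain i j where ij: "i \<in> I" "j \<notin> I" using I by blast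
    have "r' = CARD('r) \<and> m' = m"
    proof (rule gorenstein_unique[OF L0_zero L0_add gorenstein_Q g])
      show "(0, axis i 1) - p \<in> Q" "(0, axis j 1) - p \<in> Q"
        using generator_mem[OF zero_Ps] by auto
      show "(0, axis i 1) - p \<noteq> (0, axis j 1) - p"
        using ij by (auto simp: axis_eq_axis)
    qed
    moreover note face = reducible_imp_face[OF I z]
    have "(\<lambda>x. x - p) ` coord_face I face_of Q" using face(1) by (simp add: translate_face_iff)
    moreover have "(\<lambda>x. x - p) ` coord_face I \<noteq> {}" using face(2) by simp
    moreover have "(\<lambda>x. x - p) ` coord_face I \<noteq> Q"
      using face(3) by (simp add: inj_image_eq_iff inj_on_def)
    ultimately show False
      using no codeg_sum_eq[OF face_of_imp_subset[OF face(1)]] face(4) by metis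
  qed
qed

end

end

theorem theorem5p8:
  fixes M P :: "'a::euclidean_space set"
    and Ps :: "'r::finite \<Rightarrow> 'a set"
    and p :: "'a \<times> (real ^ 'r)"
  assumes "is_lattice M"
    and "reflexive M P"
    and "nef_partition M P Ps"
    and "p \<in> cayley_lattice M"
  shows "irreducible_nef_partition Ps \<longleftrightarrow>
         irreducible_gorenstein_at p (cayley_lattice M) (cayley_polytope Ps)"
proof -
  obtain U where U: "finite U" "U \<subseteq> dual_lattice M" "P = {x \<in> span M. \<forall>u\<in>U. u \<bullet> x \<le> 1}"
      "\<And>u. u \<in> U \<Longrightarrow> \<exists>x\<in>P. u \<bullet> x = 1"
    by (rule reflexive_facet_normals[OF assms(2)]) blast
  have "bounded P"
    using assms(2) unfolding reflexive_def lattice_polytope_def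
    by (auto intro: bounded_convex_hull finite_imp_bounded)
  then interpret nef M P U Ps
    using assms(1-3) U unfolding reflexive_def nef_partition_def by unfold_locales auto
  show ?thesis using assms(4) by (rule irreducible_iff)
qed

end
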